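(* Let $\Gamma$ and $\Lambda$ be two connected finite simplicial graphs admitting tree $2$-spanners $T_\Gamma$ and $T_\Lambda$, respectively. Then $BB_\Gamma\cong BB_\Lambda$ as groups if and only if $T_\Gamma^\ast\cong T_\Lambda^\ast$ as graphs.
   Context: All graphs are finite simplicial graphs. The right-angled Artin group on $\Gamma$ is $A_\Gamma=\langle V(\Gamma)\mid [v,w] \text{ whenever } (v,w)\in E(\Gamma)\rangle$, and the Bestvina--Brady group $BB_\Gamma$ is the kernel of the homomorphism $A_\Gamma\to\mathbb Z$ sending every vertex generator to $1$. A tree $2$-spanner of $\Gamma$ is a spanning tree $T$ of $\Gamma$ such that $d_T(x,y)\le 2\,d_\Gamma(x,y)$ for all $x,y\in V(\Gamma)$. The dual graph $T^\ast$ of a tree $2$-spanner $T$ of $\Gamma$ is the graph whose vertices are the edges of $T$, two of them being adjacent if and only if the corresponding edges of $T$ are contained in the same triangle of $\Gamma$. *)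

theory Defs
  imports "HOL-Algebra.Elementary_Groups" "Graph_Theory.Graph_Theory"
begin

section \<open>Groups given by generators and relators\<close>

text \<open>The letter \<open>(s, True)\<close> stands for the generator \<open>s\<close>, and \<open>(s, False)\<close> for its inverse.\<close>

type_synonym 'a word = "('a \<times> bool) list"

definition words :: "'a set \<Rightarrow> 'a word set" where
  "words S = lists (S \<times> UNIV)"

text \<open>
  The congruence on the monoid of words over \<open>S\<close> and its formal inverses that is generated by
  free cancellation and by \<open>r = 1\<close> for every relator \<open>r \<in> R\<close>. Relators are meant
  to be words over \<open>S\<close>.
\<close>

inductive pres_eq :: "'a set \<Rightarrow> 'a word set \<Rightarrow> 'a word \<Rightarrow> 'a word \<Rightarrow> bool" for S R where
  refl: "w \<in> words S \<Longrightarrow> pres_eq S R w w"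
| sym: "pres_eq S R v w \<Longrightarrow> pres_eq S R w v"
| trans: "pres_eq S R u v \<Longrightarrow> pres_eq S R v w \<Longrightarrow> pres_eq S R u w"
| cancel: "u \<in> words S \<Longrightarrow> v \<in> words S \<Longrightarrow> s \<in> S \<Longrightarrow>
    pres_eq S R (u @ [(s, b), (s, \<not> b)] @ v) (u @ v)"
| relator: "u \<in> words S \<Longrightarrow> v \<in> words S \<Longrightarrow> r \<in> R \<Longrightarrow> pres_eq S R (u @ r @ v) (u @ v)"

definition pres_class :: "'a set \<Rightarrow> 'a word set \<Rightarrow> 'a word \<Rightarrow> 'a word set" where
  "pres_class S R w = {v. pres_eq S R w v}"

definition presented_group :: "'a set \<Rightarrow> 'a word set \<Rightarrow> 'a word set monoid" where
  "presented_group S R =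
    \<lparr>carrier = pres_class S R ` words S,
     monoid.mult = (\<lambda>X Y. {w. \<exists>x\<in>X. \<exists>y\<in>Y. pres_eq S R (x @ y) w}),
     one = pres_class S R []\<rparr>"

lemma words_append [simp]: "u @ v \<in> words S \<longleftrightarrow> u \<in> words S \<and> v \<in> words S"
  by (auto simp: words_def)

lemma words_Nil [simp]: "[] \<in> words S"
  by (auto simp: words_def)

lemma words_Cons [simp]: "a # w \<in> words S \<longleftrightarrow> fst a \<in> S \<and> w \<in> words S"
  by (cases a) (auto simp: words_def)

lemma pres_eq_words:
  assumes "R \<subseteq> words S" "pres_eq S R u v"
  shows "u \<in> words S \<and> v \<in> words S"
  using assms(2) by induction (use assms(1) in auto)

lemma pres_eq_ctxt:
  assumes "pres_eq S R u v" "x \<in> words S" "y \<in> words S"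
  shows "pres_eq S R (x @ u @ y) (x @ v @ y)"
  using assms
proof induction
  case (cancel u v s b)
  then show ?case
    using pres_eq.cancel[of "x @ u" S "v @ y" s R b] by simp
next
  case (relator u v r)
  then show ?case
    using pres_eq.relator[of "x @ u" S "v @ y" r R] by simp
qed (auto intro: pres_eq.intros)

lemma pres_eq_append:
  assumes "R \<subseteq> words S" "pres_eq S R u u'" "pres_eq S R v v'"
  shows "pres_eq S R (u @ v) (u' @ v')"
  using pres_eq_ctxt[OF assms(2), of "[]" v] pres_eq_ctxt[OF assms(3), of u' "[]"]
    pres_eq_words[OF assms(1,2)] pres_eq_words[OF assms(1,3)]
  by (auto intro: pres_eq.trans)

lemma pres_class_eq_iff:
  assumes "v \<in> words S"
  shows "pres_class S R u = pres_class S R v \<longleftrightarrow> pres_eq S R u v"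
  using assms by (auto simp: pres_class_def intro: pres_eq.intros)

lemma pres_class_mult:
  assumes "R \<subseteq> words S" "u \<in> words S" "v \<in> words S"
  shows "pres_class S R u \<otimes>\<^bsub>presented_group S R\<^esub> pres_class S R v = pres_class S R (u @ v)"
proof -
  have "(\<exists>x y. pres_eq S R u x \<and> pres_eq S R v y \<and> pres_eq S R (x @ y) w) \<longleftrightarrow> pres_eq S R (u @ v) w"
    for w
    using assms by (meson pres_eq.refl pres_eq.trans pres_eq_append)
  then show ?thesis
    by (auto simp: presented_group_def pres_class_def)
qed

definition inv_word :: "'a word \<Rightarrow> 'a word" where
  "inv_word w = rev (map (\<lambda>(s, b). (s, \<not> b)) w)"

lemma inv_word_words: "w \<in> words S \<Longrightarrow> inv_word w \<in> words S"
  by (induction w) (auto simp: inv_word_def)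

lemma pres_eq_inv_word: "w \<in> words S \<Longrightarrow> pres_eq S R (inv_word w @ w) []"
proof (induction w)
  case Nil
  then show ?case by (simp add: inv_word_def pres_eq.refl)
next
  case (Cons a w)
  obtain s b where a: "a = (s, b)" by (cases a)
  have "pres_eq S R (inv_word w @ [(s, \<not> b), (s, \<not> \<not> b)] @ w) (inv_word w @ w)"
    using Cons.prems a by (intro pres_eq.cancel) (auto simp: inv_word_words)
  then have "pres_eq S R (inv_word (a # w) @ a # w) (inv_word w @ w)"
    by (simp add: a inv_word_def)
  then show ?case
    using Cons by (auto intro: pres_eq.trans)
qed

lemma group_presented_group:
  assumes "R \<subseteq> words S"
  shows "group (presented_group S R)"
proof (rule groupI)
  fix x assume "x \<in> carrier (presented_group S R)"
  then obtain u where u: "u \<in> words S" "x = pres_class S R u"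
    by (auto simp: presented_group_def)
  show "\<exists>y\<in>carrier (presented_group S R). y \<otimes>\<^bsub>presented_group S R\<^esub> x = \<one>\<^bsub>presented_group S R\<^esub>"
  proof (rule bexI[of _ "pres_class S R (inv_word u)"])
    show "pres_class S R (inv_word u) \<otimes>\<^bsub>presented_group S R\<^esub> x = \<one>\<^bsub>presented_group S R\<^esub>"
      using u pres_eq_inv_word[OF u(1), of R]
      by (simp add: pres_class_mult[OF assms] inv_word_words pres_class_eq_iff)
         (simp add: presented_group_def pres_class_eq_iff)
    show "pres_class S R (inv_word u) \<in> carrier (presented_group S R)"
      using u by (auto simp: presented_group_def inv_word_words)
  qed
  show "\<one>\<^bsub>presented_group S R\<^esub> \<otimes>\<^bsub>presented_group S R\<^esub> x = x"
    using u pres_class_mult[OF assms, of "[]" u] by (simp add: presented_group_def)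
next
  fix x y assume "x \<in> carrier (presented_group S R)" "y \<in> carrier (presented_group S R)"
  then show "x \<otimes>\<^bsub>presented_group S R\<^esub> y \<in> carrier (presented_group S R)"
    by (auto simp: presented_group_def[THEN arg_cong[where f = carrier]] pres_class_mult[OF assms])
next
  fix x y z assume "x \<in> carrier (presented_group S R)" "y \<in> carrier (presented_group S R)"
    "z \<in> carrier (presented_group S R)"
  then show "x \<otimes>\<^bsub>presented_group S R\<^esub> y \<otimes>\<^bsub>presented_group S R\<^esub> z =
      x \<otimes>\<^bsub>presented_group S R\<^esub> (y \<otimes>\<^bsub>presented_group S R\<^esub> z)"
    by (auto simp: presented_group_def[THEN arg_cong[where f = carrier]] pres_class_mult[OF assms])
qed (auto simp: presented_group_def)


section \<open>Right-angled Artin groups and Bestvina--Brady groups\<close>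

text \<open>
  A finite simplicial graph is a \<^const>\<open>pair_graph\<close>: a finite set of vertices and a finite
  symmetric irreflexive set of arcs, an undirected edge being a pair of opposite arcs.
\<close>

definition commutator_word :: "'a \<Rightarrow> 'a \<Rightarrow> 'a word" where
  "commutator_word v w = [(v, True), (w, True), (v, False), (w, False)]"

definition raag_relators :: "'a pair_pre_digraph \<Rightarrow> 'a word set" where
  "raag_relators G = {commutator_word v w | v w. (v, w) \<in> parcs G}"

definition raag :: "'a pair_pre_digraph \<Rightarrow> 'a word set monoid" where
  "raag G = presented_group (pverts G) (raag_relators G)"

definition raag_gen :: "'a pair_pre_digraph \<Rightarrow> 'a \<Rightarrow> 'a word set" where
  "raag_gen G v = pres_class (pverts G) (raag_relators G) [(v, True)]"

definition exponent_sum :: "'a word \<Rightarrow> int" where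
  "exponent_sum w = (\<Sum>(s, b)\<leftarrow>w. if b then 1 else - 1)"

text \<open>
  The homomorphism to the integers sending every vertex generator to 1, computed as the exponent
  sum of any representing word; see \<open>raag_degree_hom\<close>, \<open>raag_degree_gen\<close>,
  \<open>raag_degree_unique\<close> below.
\<close>

definition raag_degree :: "'a word set \<Rightarrow> int" where
  "raag_degree X = the_elem (exponent_sum ` X)"

definition bestvina_brady :: "'a pair_pre_digraph \<Rightarrow> 'a word set monoid" where
  "bestvina_brady G =
    (raag G)\<lparr>carrier := kernel (raag G) integer_group raag_degree\<rparr>"

lemma raag_relators_words:
  assumes "pair_wf_digraph G"
  shows "raag_relators G \<subseteq> words (pverts G)"
  using pair_wf_digraph.in_arcsD1[OF assms] pair_wf_digraph.in_arcsD2[OF assms]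
  by (auto simp: raag_relators_def commutator_word_def)

lemma group_raag: "pair_wf_digraph G \<Longrightarrow> group (raag G)"
  by (simp add: raag_def group_presented_group raag_relators_words)

lemma exponent_sum_append [simp]: "exponent_sum (u @ v) = exponent_sum u + exponent_sum v"
  by (simp add: exponent_sum_def)

lemma exponent_sum_pres_eq:
  assumes "pres_eq (pverts G) (raag_relators G) u v"
  shows "exponent_sum u = exponent_sum v"
  using assms
  by induction (auto simp: raag_relators_def commutator_word_def, auto simp: exponent_sum_def)

lemma raag_degree_class:
  assumes "w \<in> words (pverts G)"
  shows "raag_degree (pres_class (pverts G) (raag_relators G) w) = exponent_sum w"
proof -
  have "exponent_sum ` pres_class (pverts G) (raag_relators G) w = {exponent_sum w}"
    using assms by (auto simp: pres_class_def image_iff dest: exponent_sum_pres_eq intro: pres_eq.refl)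
  then show ?thesis by (simp add: raag_degree_def)
qed

lemma raag_degree_hom:
  assumes "pair_wf_digraph G"
  shows "raag_degree \<in> hom (raag G) integer_group"
proof (rule homI)
  fix x y assume "x \<in> carrier (raag G)" "y \<in> carrier (raag G)"
  then show "raag_degree (x \<otimes>\<^bsub>raag G\<^esub> y) = raag_degree x \<otimes>\<^bsub>integer_group\<^esub> raag_degree y"
    by (auto simp: raag_def presented_group_def[THEN arg_cong[where f = carrier]]
        pres_class_mult[OF raag_relators_words[OF assms]] raag_degree_class)
qed auto

lemma raag_degree_gen: "v \<in> pverts G \<Longrightarrow> raag_degree (raag_gen G v) = 1"
  by (simp add: raag_gen_def raag_degree_class) (simp add: exponent_sum_def)

lemma raag_degree_unique:
  assumes wf: "pair_wf_digraph G" and h: "h \<in> hom (raag G) integer_group"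
    and gen: "\<And>v. v \<in> pverts G \<Longrightarrow> h (raag_gen G v) = 1"
    and x: "x \<in> carrier (raag G)"
  shows "h x = raag_degree x"
proof -
  define c where "c = pres_class (pverts G) (raag_relators G)"
  note rel = raag_relators_words[OF wf]
  have c_in: "c w \<in> carrier (raag G)" if "w \<in> words (pverts G)" for w
    using that by (auto simp: raag_def presented_group_def c_def)
  have c_app: "h (c (u @ v)) = h (c u) + h (c v)"
    if "u \<in> words (pverts G)" "v \<in> words (pverts G)" for u v
    using hom_mult[OF h c_in[OF that(1)] c_in[OF that(2)]] pres_class_mult[OF rel that]
    by (simp add: c_def raag_def)
  have c_nil: "h (c []) = 0"
    using c_app[of "[]" "[]"] by simp
  have c_gen: "h (c [(s, b)]) = (if b then 1 else - 1)" if s: "s \<in> pverts G" for s b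
  proof -
    have "c ([(s, True)] @ [(s, False)]) = c []"
      using pres_eq.cancel[of "[]" "pverts G" "[]" s "raag_relators G" True] s
      by (simp add: c_def pres_class_eq_iff)
    then have "h (c [(s, True)]) + h (c [(s, False)]) = 0"
      using c_app[of "[(s, True)]" "[(s, False)]"] c_nil s by simp
    moreover have "h (c [(s, True)]) = 1"
      using gen[OF s] by (simp add: c_def raag_gen_def)
    ultimately show ?thesis by (cases b) auto
  qed
  have "h (c w) = exponent_sum w" if "w \<in> words (pverts G)" for w
    using that
  proof (induction w)
    case Nil
    then show ?case by (simp add: c_nil exponent_sum_def)
  next
    case (Cons a w)
    then show ?case
      using c_app[of "[a]" w] c_gen[of "fst a" "snd a"]
      by (auto simp: exponent_sum_def split: prod.splits)
  qed
  then show ?thesis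
    using x by (auto simp: raag_def presented_group_def c_def raag_degree_class)
qed


section \<open>Tree 2-spanners and their dual graphs\<close>

text \<open>
  The predicate \<^const>\<open>tree\<close> is for digraphs: on a symmetric digraph it counts the closed
  walk \<open>a, b, a\<close> as a cycle. A cycle of a simplicial graph has length at least 3.
\<close>

definition graph_tree :: "'a pair_pre_digraph \<Rightarrow> bool" where
  "graph_tree T \<longleftrightarrow> pair_graph T \<and> Digraph_Component.connected (with_proj T) \<and>
    \<not> (\<exists>p. pre_digraph.cycle (with_proj T) p \<and> 3 \<le> length p)"

definition graph_dist :: "'a pair_pre_digraph \<Rightarrow> 'a \<Rightarrow> 'a \<Rightarrow> ereal" where
  "graph_dist G x y = wf_digraph.\<mu> (with_proj G) (\<lambda>_. 1) x y"

definition tree_2_spanner :: "'a pair_pre_digraph \<Rightarrow> 'a pair_pre_digraph \<Rightarrow> bool" where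
  "tree_2_spanner T G \<longleftrightarrow> graph_tree T \<and> spanning (with_proj T) (with_proj G) \<and>
    (\<forall>x\<in>pverts G. \<forall>y\<in>pverts G. graph_dist T x y \<le> 2 * graph_dist G x y)"

definition undirected_edges :: "'a pair_pre_digraph \<Rightarrow> 'a set set" where
  "undirected_edges G = {{u, v} | u v. (u, v) \<in> parcs G}"

definition triangle :: "'a pair_pre_digraph \<Rightarrow> 'a \<Rightarrow> 'a \<Rightarrow> 'a \<Rightarrow> bool" where
  "triangle G x y z \<longleftrightarrow> (x, y) \<in> parcs G \<and> (y, z) \<in> parcs G \<and> (x, z) \<in> parcs G"

definition dual_graph :: "'a pair_pre_digraph \<Rightarrow> 'a pair_pre_digraph \<Rightarrow> 'a set pair_pre_digraph" where
  "dual_graph G T =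
    \<lparr>pverts = undirected_edges T,
     parcs = {(e, f). e \<in> undirected_edges T \<and> f \<in> undirected_edges T \<and> e \<noteq> f \<and>
       (\<exists>x y z. triangle G x y z \<and> e \<subseteq> {x, y, z} \<and> f \<subseteq> {x, y, z})}\<rparr>"

lemma pair_graph_dual_graph:
  assumes "pair_graph T"
  shows "pair_graph (dual_graph G T)"
proof -
  interpret pair_graph T by fact
  have "undirected_edges T = (\<lambda>(u, v). {u, v}) ` parcs T"
    by (auto simp: undirected_edges_def)
  then have fin: "finite (undirected_edges T)"
    by (simp add: pair_finite_arcs)
  have "parcs (dual_graph G T) \<subseteq> undirected_edges T \<times> undirected_edges T"
    by (auto simp: dual_graph_def)
  with fin have "finite (parcs (dual_graph G T))"
    using finite_subset by blast
  moreover have "symmetric (with_proj (dual_graph G T))"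
    by (auto simp: symmetric_def sym_def dual_graph_def)
  ultimately show ?thesis
    using fin by unfold_locales (auto simp: dual_graph_def)
qed

end

theory Submission
  imports Defs "HOL-Algebra.Bij" "Jordan_Normal_Form.Determinant" "HOL-Library.Z2"
begin

text \<open>
  Let \<open>T\<close> be a tree 2-spanner of \<open>\<Gamma>\<close>, rooted at \<open>r\<close>. Sending an oriented edge \<open>(u, v)\<close> of
  \<open>T\<close> to \<open>u v\<inverse>\<close> defines a homomorphism from the RAAG on the dual graph to \<open>BB\<^sub>\<Gamma>\<close>. Conjugation
  by \<open>r\<close> can be written down on the dual RAAG, since conjugating \<open>u v\<inverse>\<close> by \<open>r\<close> is the same as
  conjugating it by \<open>r v\<inverse>\<close>, a product along the tree path. This yields an action of \<open>A\<^sub>\<Gamma>\<close> on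
  the dual RAAG (the action on the cosets of \<open>\<langle>r\<rangle>\<close>), which shows that the homomorphism is
  bijective.

  It remains to recover a graph from its RAAG. Commuting elements \<open>x, y\<close> have exponent vectors with
  \<open>x\<^sub>a y\<^sub>b = x\<^sub>b y\<^sub>a\<close> for nonadjacent \<open>a \<noteq> b\<close>, by mapping to the Heisenberg group. Hence an
  isomorphism induces an invertible matrix \<open>M\<close> over the field with two elements such that
  \<open>M\<^sub>v\<^sub>a M\<^sub>w\<^sub>b = M\<^sub>v\<^sub>b M\<^sub>w\<^sub>a\<close> whenever \<open>v, w\<close> are adjacent and \<open>a \<noteq> b\<close> are not. Counting
  centralizers, \<open>M\<^sub>v\<^sub>a \<noteq> 0\<close> implies \<open>deg v \<le> deg a\<close>, and any permutation in the support of
  \<open>M\<close> preserves degrees. If such a permutation fails to preserve the edge \<open>v w\<close>, the images of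
  \<open>v\<close> and \<open>w\<close> have the same neighbours; the permutations of this kind cancel in pairs in
  the determinant, so that one of the others contributes to it and is a graph isomorphism.
\<close>

section \<open>Homomorphisms and actions of right-angled Artin groups\<close>

context group
begin

definition word_eval :: "('s \<Rightarrow> 'a) \<Rightarrow> 's word \<Rightarrow> 'a" where
  "word_eval f w = foldr (\<lambda>(s, b) g. (if b then f s else inv f s) \<otimes> g) w \<one>"

lemma word_eval_Nil [simp]: "word_eval f [] = \<one>"
  and word_eval_Cons [simp]:
    "word_eval f ((s, b) # w) = (if b then f s else inv f s) \<otimes> word_eval f w"
  by (simp_all add: word_eval_def)

lemma word_eval_closed [simp]:
  "f \<in> S \<rightarrow> carrier G \<Longrightarrow> w \<in> words S \<Longrightarrow> word_eval f w \<in> carrier G"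
  by (induction w) (auto simp: Pi_iff)

lemma word_eval_append:
  assumes "f \<in> S \<rightarrow> carrier G" "v \<in> words S"
  shows "u \<in> words S \<Longrightarrow> word_eval f (u @ v) = word_eval f u \<otimes> word_eval f v"
proof (induction u)
  case (Cons a u)
  then show ?case
    using assms by (cases a) (auto simp: Pi_iff m_assoc)
qed (use assms in simp)

lemma word_eval_pres_eq:
  assumes f: "f \<in> S \<rightarrow> carrier G" and R: "R \<subseteq> words S" "\<And>r. r \<in> R \<Longrightarrow> word_eval f r = \<one>"
    and "pres_eq S R u v"
  shows "word_eval f u = word_eval f v"
  using assms(4)
proof induction
  case (cancel u v s b)
  then have "f s \<in> carrier G" using f by auto
  then have "word_eval f [(s, b), (s, \<not> b)] = \<one>" by simp
  then show ?case
    using cancel word_eval_append[OF f, of "[(s, b), (s, \<not> b)] @ v" u]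
      word_eval_append[OF f, of v "[(s, b), (s, \<not> b)]"] word_eval_append[OF f, of v u] f
    by simp
next
  case (relator u v r)
  then show ?case
    using word_eval_append[OF f, of "r @ v" u] word_eval_append[OF f, of v r]
      word_eval_append[OF f, of v u] f R by (simp add: subset_iff)
qed simp_all

lemma presented_group_lift:
  assumes f: "f \<in> S \<rightarrow> carrier G" and R: "R \<subseteq> words S" "\<And>r. r \<in> R \<Longrightarrow> word_eval f r = \<one>"
  shows "\<exists>h \<in> hom (presented_group S R) G. \<forall>w \<in> words S. h (pres_class S R w) = word_eval f w"
proof -
  \<comment> \<open>Any representative will do, since \<open>word_eval f\<close> is constant on
    congruence classes.\<close>
  define h where "h X = word_eval f (SOME w. w \<in> X)" for X
  have h: "h (pres_class S R w) = word_eval f w" if "w \<in> words S" for w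
  proof -
    have "w \<in> pres_class S R w" using that by (simp add: pres_class_def pres_eq.refl)
    then have "(SOME v. v \<in> pres_class S R w) \<in> pres_class S R w" by (rule someI)
    then show ?thesis
      unfolding h_def pres_class_def using word_eval_pres_eq[OF f R] by auto
  qed
  moreover have "h \<in> hom (presented_group S R) G"
  proof (rule homI)
    fix x y assume "x \<in> carrier (presented_group S R)" "y \<in> carrier (presented_group S R)"
    then obtain u v where "u \<in> words S" "x = pres_class S R u" "v \<in> words S" "y = pres_class S R v"
      by (auto simp: presented_group_def)
    then show "h (x \<otimes>\<^bsub>presented_group S R\<^esub> y) = h x \<otimes> h y"
      using f R by (simp add: pres_class_mult h word_eval_append)
  qed (use f h in \<open>auto simp: presented_group_def\<close>)
  ultimately show ?thesis by blast
qed

end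

section \<open>Induction, homomorphisms and actions in terms of vertex generators\<close>

lemma raag_gen_closed [simp]: "v \<in> pverts G \<Longrightarrow> raag_gen G v \<in> carrier (raag G)"
  by (auto simp: raag_gen_def raag_def presented_group_def)

context
  fixes G :: "'a pair_pre_digraph"
  assumes wf: "pair_wf_digraph G"
begin

interpretation A: group "raag G"
  by (rule group_raag[OF wf])

lemma raag_gen_inv:
  assumes "v \<in> pverts G"
  shows "inv\<^bsub>raag G\<^esub> raag_gen G v = pres_class (pverts G) (raag_relators G) [(v, False)]"
proof (rule A.inv_equality)
  have "pres_eq (pverts G) (raag_relators G) ([] @ [(v, False), (v, \<not> False)] @ []) ([] @ [])"
    using assms by (intro pres_eq.cancel) auto
  then show "pres_class (pverts G) (raag_relators G) [(v, False)] \<otimes>\<^bsub>raag G\<^esub> raag_gen G v = \<one>\<^bsub>raag G\<^esub>"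
    using assms pres_class_mult[OF raag_relators_words[OF wf], of "[(v, False)]" "[(v, True)]"]
    by (simp add: raag_def raag_gen_def pres_class_eq_iff) 
      (simp add: presented_group_def pres_class_eq_iff)
qed (use assms in \<open>auto simp: raag_gen_def raag_def presented_group_def\<close>)

text \<open>Letters are prepended on the left, which suits left actions: a longer word acts by its
  first letter on the result for the rest.\<close>

lemma raag_induct [consumes 1, case_names one gen inv_gen]:
  assumes "x \<in> carrier (raag G)"
    and one: "P \<one>\<^bsub>raag G\<^esub>"
    and gen: "\<And>v x. v \<in> pverts G \<Longrightarrow> x \<in> carrier (raag G) \<Longrightarrow> P x \<Longrightarrow> P (raag_gen G v \<otimes>\<^bsub>raag G\<^esub> x)"
    and inv: "\<And>v x. v \<in> pverts G \<Longrightarrow> x \<in> carrier (raag G) \<Longrightarrow> P x \<Longrightarrow>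
      P (inv\<^bsub>raag G\<^esub> raag_gen G v \<otimes>\<^bsub>raag G\<^esub> x)"
  shows "P x"
proof -
  let ?c = "pres_class (pverts G) (raag_relators G)"
  have "P (?c w)" if "w \<in> words (pverts G)" for w
    using that
  proof (induction w)
    case Nil
    then show ?case using one by (simp add: raag_def presented_group_def)
  next
    case (Cons a w)
    obtain v b where a: "a = (v, b)" by (cases a)
    have "?c (a # w) = (if b then raag_gen G v else inv\<^bsub>raag G\<^esub> raag_gen G v) \<otimes>\<^bsub>raag G\<^esub> ?c w"
      using Cons.prems a pres_class_mult[OF raag_relators_words[OF wf], of "[a]" w]
      by (cases b) (simp_all add: raag_gen_inv, simp_all add: raag_def raag_gen_def)
    moreover have "?c w \<in> carrier (raag G)"
      using Cons.prems by (auto simp: raag_def presented_group_def)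
    ultimately show ?case
      using Cons gen[of v] inv[of v] a by auto
  qed
  then show ?thesis
    using assms(1) by (auto simp: raag_def presented_group_def)
qed

lemma raag_hom_eqI:
  assumes "group H" "h \<in> hom (raag G) H" "k \<in> hom (raag G) H"
    and "\<And>v. v \<in> pverts G \<Longrightarrow> h (raag_gen G v) = k (raag_gen G v)" "x \<in> carrier (raag G)"
  shows "h x = k x"
proof -
  interpret h: group_hom "raag G" H h
    using assms A.group_axioms by (simp add: group_hom_def group_hom_axioms_def)
  interpret k: group_hom "raag G" H k
    using assms A.group_axioms by (simp add: group_hom_def group_hom_axioms_def)
  show ?thesis
    using assms(5) by (induction rule: raag_induct) (simp_all add: assms(4))
qed

lemma raag_gen_commute:
  assumes "(v, w) \<in> parcs G"
  shows "raag_gen G v \<otimes>\<^bsub>raag G\<^esub> raag_gen G w = raag_gen G w \<otimes>\<^bsub>raag G\<^esub> raag_gen G v"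
proof -
  note V = pair_wf_digraph.in_arcsD1[OF wf assms] pair_wf_digraph.in_arcsD2[OF wf assms]
  let ?c = "pres_class (pverts G) (raag_relators G)"
  have c: "?c (u @ u') = ?c u \<otimes>\<^bsub>raag G\<^esub> ?c u'"
    if "u \<in> words (pverts G)" "u' \<in> words (pverts G)" for u u'
    using pres_class_mult[OF raag_relators_words[OF wf] that] by (simp add: raag_def)
  have "commutator_word v w \<in> raag_relators G" using assms by (auto simp: raag_relators_def)
  then have "pres_eq (pverts G) (raag_relators G) ([] @ commutator_word v w @ []) ([] @ [])"
    by (intro pres_eq.relator) auto
  then have "?c (commutator_word v w) = \<one>\<^bsub>raag G\<^esub>"
    by (simp add: raag_def pres_class_eq_iff) (simp add: presented_group_def pres_class_eq_iff)
  moreover have "?c (commutator_word v w) = raag_gen G v \<otimes>\<^bsub>raag G\<^esub> (raag_gen G w \<otimes>\<^bsub>raag G\<^esub>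
      (inv\<^bsub>raag G\<^esub> raag_gen G v \<otimes>\<^bsub>raag G\<^esub> inv\<^bsub>raag G\<^esub> raag_gen G w))"
    using V c[of "[(v, True)]" "[(w, True), (v, False), (w, False)]"]
      c[of "[(w, True)]" "[(v, False), (w, False)]"] c[of "[(v, False)]" "[(w, False)]"]
    by (simp add: commutator_word_def raag_gen_inv) (simp add: raag_gen_def)
  ultimately have "raag_gen G v \<otimes>\<^bsub>raag G\<^esub> raag_gen G w \<otimes>\<^bsub>raag G\<^esub>
      inv\<^bsub>raag G\<^esub> (raag_gen G w \<otimes>\<^bsub>raag G\<^esub> raag_gen G v) = \<one>\<^bsub>raag G\<^esub>"
    using V by (simp add: A.inv_mult_group A.m_assoc)
  then show ?thesis
    using V A.inv_solve_right'[of "\<one>\<^bsub>raag G\<^esub>" "raag_gen G v \<otimes>\<^bsub>raag G\<^esub> raag_gen G w"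
        "raag_gen G w \<otimes>\<^bsub>raag G\<^esub> raag_gen G v"] by simp
qed

lemma raag_lift:
  assumes "group H" and f: "f \<in> pverts G \<rightarrow> carrier H"
    and comm: "\<And>v w. (v, w) \<in> parcs G \<Longrightarrow> f v \<otimes>\<^bsub>H\<^esub> f w = f w \<otimes>\<^bsub>H\<^esub> f v"
  obtains h where "h \<in> hom (raag G) H" "\<And>v. v \<in> pverts G \<Longrightarrow> h (raag_gen G v) = f v"
proof -
  interpret H: group H by fact
  have "H.word_eval f r = \<one>\<^bsub>H\<^esub>" if r: "r \<in> raag_relators G" for r
  proof -
    obtain v w where vw: "(v, w) \<in> parcs G" "r = commutator_word v w"
      using r by (auto simp: raag_relators_def)
    then have "f v \<in> carrier H" "f w \<in> carrier H"
      using f pair_wf_digraph.in_arcsD1[OF wf] pair_wf_digraph.in_arcsD2[OF wf] by blast+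
    moreover from this have "H.word_eval f r = f v \<otimes>\<^bsub>H\<^esub> f w \<otimes>\<^bsub>H\<^esub> inv\<^bsub>H\<^esub> (f w \<otimes>\<^bsub>H\<^esub> f v)"
      by (simp add: vw commutator_word_def H.inv_mult_group H.m_assoc)
    ultimately show ?thesis using comm[OF vw(1)] by simp
  qed
  then obtain h where h: "h \<in> hom (raag G) H"
      "\<forall>w \<in> words (pverts G). h (pres_class (pverts G) (raag_relators G) w) = H.word_eval f w"
    using H.presented_group_lift[OF f raag_relators_words[OF wf]] by (auto simp: raag_def)
  show thesis
    using h f by (intro that[of h]) (auto simp: raag_gen_def Pi_iff)
qed

text \<open>This is \<open>raag_lift\<close> with the group of bijections of \<open>X\<close> as
  target. The inverse maps \<open>g\<close> are kept explicit so that the action of an inverse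
  generator can be computed.\<close>

lemma raag_action:
  assumes closed: "\<And>v x. v \<in> pverts G \<Longrightarrow> x \<in> X \<Longrightarrow> f v x \<in> X"
      "\<And>v x. v \<in> pverts G \<Longrightarrow> x \<in> X \<Longrightarrow> g v x \<in> X"
    and inv: "\<And>v x. v \<in> pverts G \<Longrightarrow> x \<in> X \<Longrightarrow> g v (f v x) = x"
      "\<And>v x. v \<in> pverts G \<Longrightarrow> x \<in> X \<Longrightarrow> f v (g v x) = x"
    and comm: "\<And>v w x. (v, w) \<in> parcs G \<Longrightarrow> x \<in> X \<Longrightarrow> f v (f w x) = f w (f v x)"
  obtains \<rho> where "\<And>x. x \<in> X \<Longrightarrow> \<rho> \<one>\<^bsub>raag G\<^esub> x = x"
    "\<And>a b x. a \<in> carrier (raag G) \<Longrightarrow> b \<in> carrier (raag G) \<Longrightarrow> x \<in> X \<Longrightarrow>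
      \<rho> (a \<otimes>\<^bsub>raag G\<^esub> b) x = \<rho> a (\<rho> b x)"
    "\<And>a x. a \<in> carrier (raag G) \<Longrightarrow> x \<in> X \<Longrightarrow> \<rho> a x \<in> X"
    "\<And>v x. v \<in> pverts G \<Longrightarrow> x \<in> X \<Longrightarrow> \<rho> (raag_gen G v) x = f v x"
    "\<And>v x. v \<in> pverts G \<Longrightarrow> x \<in> X \<Longrightarrow> \<rho> (inv\<^bsub>raag G\<^esub> raag_gen G v) x = g v x"
proof -
  interpret B: group "BijGroup X" by (rule group_BijGroup)
  \<comment> \<open>\<open>Bij X\<close> contains only functions that are undefined off
    \<open>X\<close>, hence the \<open>restrict\<close>.\<close>
  have bij: "restrict (f v) X \<in> Bij X" if "v \<in> pverts G" for v
  proof -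
    have "bij_betw (f v) X X"
      using that closed inv by (intro bij_betw_byWitness[where f' = "g v"]) auto
    then show ?thesis by (simp add: Bij_def)
  qed
  have comm_bij: "restrict (f v) X \<otimes>\<^bsub>BijGroup X\<^esub> restrict (f w) X =
      restrict (f w) X \<otimes>\<^bsub>BijGroup X\<^esub> restrict (f v) X" if vw: "(v, w) \<in> parcs G" for v w
  proof -
    have "v \<in> pverts G" "w \<in> pverts G"
      using vw pair_wf_digraph.in_arcsD1[OF wf] pair_wf_digraph.in_arcsD2[OF wf] by blast+
    then show ?thesis
      using bij comm[OF vw] closed by (auto simp: BijGroup_def compose_def fun_eq_iff)
  qed
  have "(\<lambda>v. restrict (f v) X) \<in> pverts G \<rightarrow> carrier (BijGroup X)"
    using bij by (simp add: BijGroup_def)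
  from raag_lift[OF B.group_axioms this comm_bij]
  obtain \<rho> where \<rho>: "\<rho> \<in> hom (raag G) (BijGroup X)"
    "\<And>v. v \<in> pverts G \<Longrightarrow> \<rho> (raag_gen G v) = restrict (f v) X"
    by auto
  have \<rho>_in: "\<rho> a \<in> Bij X" if "a \<in> carrier (raag G)" for a
    using hom_in_carrier[OF \<rho>(1) that] by (simp add: BijGroup_def)
  have one: "\<rho> \<one>\<^bsub>raag G\<^esub> x = x" if "x \<in> X" for x
    using hom_one[OF \<rho>(1) A.group_axioms B.group_axioms] that by (simp add: BijGroup_def)
  have mult: "\<rho> (a \<otimes>\<^bsub>raag G\<^esub> b) x = \<rho> a (\<rho> b x)"
    if "a \<in> carrier (raag G)" "b \<in> carrier (raag G)" "x \<in> X" for a b x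
    using hom_mult[OF \<rho>(1) that(1,2)] \<rho>_in that by (simp add: BijGroup_def compose_def)
  have closed': "\<rho> a x \<in> X" if "a \<in> carrier (raag G)" "x \<in> X" for a x
    using \<rho>_in[OF that(1)] that(2) by (auto simp: Bij_def bij_betw_def)
  have "\<rho> (inv\<^bsub>raag G\<^esub> raag_gen G v) x = g v x" if v: "v \<in> pverts G" and x: "x \<in> X" for v x
  proof -
    \<comment> \<open>The trivial element fixes \<open>g v x\<close>, and its right factor moves
      \<open>g v x\<close> to \<open>x\<close>.\<close>
    have "\<rho> (inv\<^bsub>raag G\<^esub> raag_gen G v \<otimes>\<^bsub>raag G\<^esub> raag_gen G v) (g v x) =
        \<rho> (inv\<^bsub>raag G\<^esub> raag_gen G v) (\<rho> (raag_gen G v) (g v x))"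
      using v x closed by (intro mult) auto
    then show ?thesis using v x closed inv \<rho>(2) one by simp
  qed
  then show thesis
    using that[OF one mult closed'] \<rho>(2) by simp
qed

end


section \<open>Commuting matrices over the field with two elements\<close>

text \<open>These rules would turn the field operations of \<open>bit\<close> into bitwise ones and
  hide sums and products from ring reasoning.\<close>

declare add_bit_eq_xor [simp del] mult_bit_eq_and [simp del]

section \<open>Counting and cancellation over the field with two elements\<close>

lemma card_bit: "card (UNIV :: bit set) = 2"
proof -
  have "(UNIV :: bit set) = {0, 1}"
    using bit_not_zero_iff by blast
  then have "card (UNIV :: bit set) = card {0, 1 :: bit}" by (rule arg_cong)
  then show ?thesis by simp
qed

lemma mult_eq_1_bit: "a * b = 1 \<longleftrightarrow> a = 1 \<and> b = 1" for a b :: bit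
  by (cases a; cases b) simp_all

lemma finite_bit: "finite (UNIV :: bit set)"
  by (rule card_ge_0_finite) (simp add: card_bit)

lemma card_bit_vectors: "finite S \<Longrightarrow> card (S \<rightarrow>\<^sub>E (UNIV :: bit set)) = 2 ^ card S"
  by (simp add: card_PiE card_bit)

text \<open>The set splits into pairs \<open>{p, t p}\<close>, each contributing
  \<open>f p + f p = 0\<close>.\<close>

lemma sum_involution_bit:
  fixes f :: "'a \<Rightarrow> bit"
  assumes "finite B" "\<And>p. p \<in> B \<Longrightarrow> t p \<in> B" "\<And>p. p \<in> B \<Longrightarrow> t (t p) = p"
    "\<And>p. p \<in> B \<Longrightarrow> t p \<noteq> p" "\<And>p. p \<in> B \<Longrightarrow> f (t p) = f p"
  shows "sum f B = 0"
  using assms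
proof (induction rule: finite_psubset_induct)
  case (psubset B)
  show ?case
  proof (cases "B = {}")
    case False
    then obtain p where p: "p \<in> B" by blast
    have "sum f (B - {p, t p}) = 0"
    proof (rule psubset.IH)
      show "t q \<in> B - {p, t p}" if "q \<in> B - {p, t p}" for q
        using that psubset.prems(1,2) p by (metis Diff_iff insert_iff singletonD)
    qed (use psubset.prems p in auto)
    moreover have "sum f B = f p + (f (t p) + sum f (B - {p, t p}))"
      using p psubset.prems(1,3) psubset.hyps
      by (simp add: sum.remove[of B p] sum.remove[of "B - {p}" "t p"] Diff_insert2[symmetric])
    ultimately show ?thesis using psubset.prems(4)[OF p] by simp
  qed simp
qed

text \<open>In the main application \<open>S\<close> is the closed star of a vertex
  \<open>v\<close>, row \<open>w\<close> of \<open>M\<close> holds the exponents mod 2 of the image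
  of \<open>w\<close>, and \<open>x\<close> is row \<open>v\<close>. \<open>MN\<close> makes the
  rows indexed by \<open>S\<close> linearly independent; \<open>comm\<close> is the constraint on
  exponent vectors of commuting elements.\<close>

context
  fixes W :: "'b set" and S :: "'a set" and M :: "'a \<Rightarrow> 'b \<Rightarrow> bit" and N :: "'b \<Rightarrow> 'a \<Rightarrow> bit"
    and F :: "'b \<Rightarrow> 'b \<Rightarrow> bool" and x :: "'b \<Rightarrow> bit" and a :: 'b
  assumes fin: "finite W" "finite S"
    and MN: "\<And>v w. v \<in> S \<Longrightarrow> w \<in> S \<Longrightarrow> (\<Sum>b\<in>W. M v b * N b w) = (if v = w then 1 else 0)"
    and comm: "\<And>w b c. w \<in> S \<Longrightarrow> b \<in> W \<Longrightarrow> c \<in> W \<Longrightarrow> b \<noteq> c \<Longrightarrow> \<not> F b c \<Longrightarrow>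
      x b * M w c = x c * M w b"
    and a: "a \<in> W" "x a = 1"
begin

abbreviation comb :: "('a \<Rightarrow> bit) \<Rightarrow> 'b \<Rightarrow> bit" where
  "comb z b \<equiv> \<Sum>w\<in>S. z w * M w b"

abbreviation star :: "'b set" where
  "star \<equiv> {b \<in> W. b = a \<or> F a b}"

text \<open>The constraint \<open>comm\<close> is linear in the row, so it passes to linear
  combinations.\<close>

lemma comb_commute:
  assumes "b \<in> W" "c \<in> W" "b \<noteq> c" "\<not> F b c"
  shows "x b * comb z c = x c * comb z b"
proof -
  have "x b * (z w * M w c) = x c * (z w * M w b)" if "w \<in> S" for w
    using comm[OF that assms] by (metis mult.left_commute)
  then show ?thesis by (simp only: sum_distrib_left cong: sum.cong)
qed

text \<open>
  A vector commuting with \<open>x\<close> is determined by its coordinates in the star of \<open>a\<close>: for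
  \<open>b\<close> outside it, \<open>x a * y b = x b * y a\<close> recovers \<open>y b\<close>.
\<close>

lemma comb_inj: "inj_on (\<lambda>z. restrict (comb z) star) (S \<rightarrow>\<^sub>E UNIV)"
proof (rule inj_onI)
  fix z z' assume z: "z \<in> S \<rightarrow>\<^sub>E UNIV" "z' \<in> S \<rightarrow>\<^sub>E UNIV"
    and eq: "restrict (comb z) star = restrict (comb z') star"
  have star: "comb z b = comb z' b" if "b \<in> star" for b
    using fun_cong[OF eq, of b] that by simp
  have eq_W: "comb z b = comb z' b" if b: "b \<in> W" for b
  proof (cases "b \<in> star")
    case False
    then have ab: "a \<noteq> b" "\<not> F a b" using b by auto
    show ?thesis
      using comb_commute[OF a(1) b ab, of z] comb_commute[OF a(1) b ab, of z'] a star[of a] by simp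
  qed (rule star)
  \<comment> \<open>\<open>N\<close> is a right inverse of \<open>M\<close> on the rows in
    \<open>S\<close>, so it recovers the coefficients of a combination.\<close>
  have val: "(\<Sum>b\<in>W. comb y b * N b w) = y w" if "w \<in> S" for y w
  proof -
    have "(\<Sum>b\<in>W. comb y b * N b w) = (\<Sum>v\<in>S. y v * (\<Sum>b\<in>W. M v b * N b w))"
      by (simp add: sum_distrib_right sum_distrib_left mult.assoc sum.swap[of _ W])
    also have "\<dots> = (\<Sum>v\<in>S. if v = w then y v else 0)"
      using that by (intro sum.cong) (auto simp: MN)
    finally show ?thesis using that fin by simp
  qed
  have "z w = z' w" if "w \<in> S" for w
    using val[OF that, of z] val[OF that, of z'] eq_W by simp
  with z show "z = z'" by (metis PiE_ext)
qed

text \<open>By \<open>comb_inj\<close> the \<open>2 ^ card S\<close> combinations embed into the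
  \<open>2 ^ card star\<close> vectors on the star.\<close>

lemma card_le_star: "card S \<le> card star"
proof -
  have "card (S \<rightarrow>\<^sub>E (UNIV :: bit set)) \<le> card (star \<rightarrow>\<^sub>E (UNIV :: bit set))"
    using fin finite_bit by (intro card_inj_on_le[OF comb_inj] finite_PiE image_subsetI restrict_PiE_iff[THEN iffD2]) auto
  then show ?thesis using fin by (simp add: card_bit_vectors)
qed

text \<open>When the counting bound is attained, restriction to the star is also onto, so a vector
  commuting with \<open>x\<close> can be prescribed freely on the star of \<open>a\<close>.\<close>

lemma nbhd_subset:
  assumes eq: "card S = card star" and b: "b \<in> W" "x b = 1" "b \<noteq> a" "\<not> F a b"
    and sym: "\<And>c d. F c d \<Longrightarrow> F d c" and irr: "\<And>c. \<not> F c c"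
    and c: "c \<in> W" "F a c"
  shows "F b c"
proof (rule ccontr)
  assume nF: "\<not> F b c"
  have "(\<lambda>z. restrict (comb z) star) ` (S \<rightarrow>\<^sub>E UNIV) = star \<rightarrow>\<^sub>E UNIV"
    using fin finite_bit eq
    by (intro card_subset_eq finite_PiE image_subsetI restrict_PiE_iff[THEN iffD2])
      (auto simp: card_image[OF comb_inj] card_bit_vectors)
  \<comment> \<open>The indicator of \<open>c\<close> vanishes at \<open>a\<close>. Comparing
    \<open>a\<close> with \<open>b\<close> shows that its extension vanishes at \<open>b\<close>,
    and comparing \<open>b\<close> with \<open>c\<close> then gives \<open>1 = 0\<close>.\<close>
  moreover have "(\<lambda>d\<in>star. if d = c then 1 else 0) \<in> star \<rightarrow>\<^sub>E (UNIV :: bit set)" by auto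
  ultimately obtain z where z: "restrict (comb z) star = (\<lambda>d\<in>star. if d = c then 1 else 0)"
    by (metis (no_types, lifting) imageE)
  have "comb z a = 0" "comb z c = 1"
    using fun_cong[OF z, of a] fun_cong[OF z, of c] a c irr by auto
  moreover have "x a * comb z b = x b * comb z a"
    using a b by (intro comb_commute) auto
  moreover have "x b * comb z c = x c * comb z b"
    using b c nF by (intro comb_commute) auto
  ultimately show False using a b by simp
qed

end

section \<open>Invertible matrices over \<open>bit\<close>: cardinality and determinant\<close>

lemma card_le_of_left_inverse:
  fixes M :: "'a \<Rightarrow> 'b \<Rightarrow> bit"
  assumes "finite W" "finite S"
    and MN: "\<And>v w. v \<in> S \<Longrightarrow> w \<in> S \<Longrightarrow> (\<Sum>b\<in>W. M v b * N b w) = (if v = w then 1 else 0)"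
  shows "card S \<le> card W"
proof (cases "W = {}")
  case True
  then have "S = {}" using MN by fastforce
  then show ?thesis by simp
next
  case False
  then obtain a where a: "a \<in> W" by blast
  \<comment> \<open>With \<open>F\<close> constantly true the commutation hypothesis is vacuous and
    the star of \<open>a\<close> is all of \<open>W\<close>.\<close>
  have "card S \<le> card {b \<in> W. b = a \<or> b \<noteq> a}"
    using assms a card_le_star[of W S M N "\<lambda>b c. True" "\<lambda>_. 1" a] by simp
  then show ?thesis by simp
qed

text \<open>Signs of permutations are 1 in characteristic 2, so the sum is the determinant of an
  invertible matrix, and 1 is the only unit of \<open>bit\<close>.\<close>

lemma sum_permutations_eq_1:
  fixes M N :: "nat \<Rightarrow> nat \<Rightarrow> bit"
  assumes MN: "\<And>i j. i < n \<Longrightarrow> j < n \<Longrightarrow> (\<Sum>k<n. M i k * N k j) = (if i = j then 1 else 0)"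
  shows "(\<Sum>p | p permutes {..<n}. \<Prod>i<n. M i (p i)) = 1"
proof -
  let ?A = "mat n n (\<lambda>(i, j). M i j)" and ?B = "mat n n (\<lambda>(i, j). N i j)"
  have "?A * ?B = 1\<^sub>m n"
    by (rule eq_matI) (simp_all add: scalar_prod_def MN lessThan_atLeast0[symmetric])
  then have "det ?A * det ?B = 1"
    by (metis det_mult det_one mat_carrier)
  then have "det ?A = 1" by (metis bit_not_zero_iff mult_zero_left zero_neq_one)
  moreover have "det ?A = (\<Sum>p | p permutes {..<n}. \<Prod>i<n. M i (p i))"
  proof -
    have "(of_int (sign p) :: bit) = 1" for p :: "nat \<Rightarrow> nat" by (simp add: sign_def)
    then show ?thesis
      by (simp add: det_def lessThan_atLeast0 permutes_in_image cong: sum.cong)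
        (intro sum.cong prod.cong; auto simp: permutes_in_image)
  qed
  ultimately show ?thesis by simp
qed

text \<open>Both vertex sets are numbered by \<open>{..<n}\<close>, so that a matching of vertices
  is a permutation and determinants apply. \<open>E\<close> and \<open>F\<close> are the two
  adjacency relations, and \<open>M\<close> is the exponent matrix mod 2.\<close>

context
  fixes n :: nat and E F :: "nat \<Rightarrow> nat \<Rightarrow> bool" and M N :: "nat \<Rightarrow> nat \<Rightarrow> bit"
  assumes sym: "\<And>i j. E i j \<Longrightarrow> E j i" "\<And>i j. F i j \<Longrightarrow> F j i"
    and irr: "\<And>i. \<not> E i i" "\<And>i. \<not> F i i"
    and MN: "\<And>i j. i < n \<Longrightarrow> j < n \<Longrightarrow> (\<Sum>k<n. M i k * N k j) = (if i = j then 1 else 0)"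
    and commM: "\<And>v w a b. v < n \<Longrightarrow> w < n \<Longrightarrow> a < n \<Longrightarrow> b < n \<Longrightarrow> E v w \<Longrightarrow> a \<noteq> b \<Longrightarrow> \<not> F a b \<Longrightarrow>
      M v a * M w b = M v b * M w a"
begin

abbreviation nbE :: "nat \<Rightarrow> nat set" where "nbE i \<equiv> {j. j < n \<and> E i j}"
abbreviation nbF :: "nat \<Rightarrow> nat set" where "nbF i \<equiv> {j. j < n \<and> F i j}"

lemma star_nat:
  assumes "i < n" "\<And>i. \<not> R i i"
  shows "card {j \<in> {..<n}. j = i \<or> R i j} = Suc (card {j. j < n \<and> R i j})"
proof -
  have "{j \<in> {..<n}. j = i \<or> R i j} = insert i {j. j < n \<and> R i j}" using assms by auto
  then show ?thesis using assms by simp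
qed

lemma star_rows_commute:
  assumes "v < n" "w \<in> {j \<in> {..<n}. j = v \<or> E v j}" "b \<in> {..<n}" "c \<in> {..<n}" "b \<noteq> c" "\<not> F b c"
  shows "M v b * M w c = M v c * M w b"
proof (cases "w = v")
  case False
  then show ?thesis using assms commM[of v w b c] by simp
qed (simp add: mult.commute)

text \<open>The counting bound is applied to the closed star of \<open>v\<close>, all of whose rows
  commute with row \<open>v\<close>.\<close>

lemma deg_le:
  assumes "v < n" "a < n" "M v a = 1"
  shows "card (nbE v) \<le> card (nbF a)"
proof -
  have "card {j \<in> {..<n}. j = v \<or> E v j} \<le> card {b \<in> {..<n}. b = a \<or> F a b}"
    by (rule card_le_star[where M = M and N = N and x = "M v"])
      (use assms MN star_rows_commute[OF assms(1)] in simp_all)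
  then show ?thesis using star_nat[of v E] star_nat[of a F] assms irr by simp
qed

text \<open>Equal degrees mean that the counting bound is attained, which is the situation of
  \<open>nbhd_subset\<close>.\<close>

lemma nbF_subset:
  assumes "v < n" "a < n" "M v a = 1" "card (nbE v) = card (nbF a)"
    and "b < n" "M v b = 1" "b \<noteq> a" "\<not> F a b"
  shows "nbF a \<subseteq> nbF b"
proof
  fix c assume c: "c \<in> nbF a"
  have "F b c"
  proof (rule nbhd_subset[where M = M and N = N and x = "M v" and a = a and W = "{..<n}"
        and S = "{j \<in> {..<n}. j = v \<or> E v j}"])
    show "card {j \<in> {..<n}. j = v \<or> E v j} = card {b \<in> {..<n}. b = a \<or> F a b}"
      using star_nat[of v E] star_nat[of a F] assms irr by simp
  qed (use assms MN star_rows_commute[OF assms(1)] sym irr c in simp_all)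
  then show "c \<in> nbF b" using c by simp
qed

text \<open>An edge whose ends are sent to twins. As \<open>F\<close> is irreflexive, twins below
  \<open>n\<close> are not adjacent, so a permutation of \<open>{..<n}\<close> does not preserve a
  clashing edge.\<close>

definition clash :: "(nat \<Rightarrow> nat) \<Rightarrow> nat \<times> nat \<Rightarrow> bool" where
  "clash p = (\<lambda>(v, w). v < n \<and> w < n \<and> E v w \<and> nbF (p v) = nbF (p w))"

text \<open>
  Whether \<open>p\<close> has a clash depends only on the map \<open>i \<mapsto> nbF (p i)\<close>. Choosing a clashing
  pair as a function of that map and swapping the two values of \<open>p\<close> is therefore an involution, and
  it preserves the product because vertices with equal neighbourhoods are not adjacent.
\<close>

lemma clash_cancel:
  "(\<Sum>p | p permutes {..<n} \<and> (\<exists>e. clash p e). \<Prod>i<n. M i (p i)) = 0"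
proof -
  define e where "e p = (SOME e. clash p e)" for p
  define t where "t p = p \<circ> Transposition.transpose (fst (e p)) (snd (e p))" for p
  have *: "clash p (e p)" if "\<exists>e. clash p e" for p
    unfolding e_def using that by (rule someI_ex)
  have props: "fst (e p) < n" "snd (e p) < n" "E (fst (e p)) (snd (e p))" "fst (e p) \<noteq> snd (e p)"
      "nbF (p (fst (e p))) = nbF (p (snd (e p)))" if "\<exists>e. clash p e" for p
    using *[OF that] irr by (auto simp: clash_def split: prod.splits)
  have nb_t: "nbF (t p i) = nbF (p i)" if "\<exists>e. clash p e" for p i
    using props(5)[OF that] by (auto simp: t_def Transposition.transpose_def)
  have clash_t: "clash (t p) = clash p" if "\<exists>e. clash p e" for p
    using nb_t[OF that] by (simp add: clash_def)
  have e_t: "e (t p) = e p" if "\<exists>e. clash p e" for p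
    using clash_t[OF that] by (simp add: e_def)
  show ?thesis
  proof (rule sum_involution_bit[where t = t])
    show "finite {p. p permutes {..<n} \<and> (\<exists>e. clash p e)}"
      by (rule finite_subset[OF _ finite_permutations[of "{..<n}"]]) auto
  next
    fix p assume "p \<in> {p. p permutes {..<n} \<and> (\<exists>e. clash p e)}"
    then have p: "p permutes {..<n}" and cl: "\<exists>e. clash p e" by auto
    note pr = props[OF cl]
    show "t p \<in> {p. p permutes {..<n} \<and> (\<exists>e. clash p e)}"
      using cl clash_t[OF cl] pr p by (simp add: t_def permutes_compose permutes_swap_id)
    show "t (t p) = p"
      unfolding t_def[of "t p"] e_t[OF cl] by (simp add: t_def comp_assoc)
    show "t p \<noteq> p"
    proof
      assume "t p = p"
      then have "p (snd (e p)) = p (fst (e p))" by (metis comp_apply t_def transpose_apply_first)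
      then show False using pr(4) permutes_inj[OF p] by (metis injD)
    qed
    define v w where "v = fst (e p)" and "w = snd (e p)"
    have vw: "v < n" "w < n" "v \<noteq> w" "E v w" "nbF (p v) = nbF (p w)"
      using pr by (simp_all add: v_def w_def)
    have "p v < n" "p w < n" using permutes_in_image[OF p] vw by auto
    moreover have "p v \<noteq> p w" using permutes_inj[OF p] vw by (metis injD)
    moreover have "\<not> F (p v) (p w)" using vw irr \<open>p w < n\<close> by blast
    ultimately have "M v (p w) * M w (p v) = M v (p v) * M w (p w)"
      using commM[of v w "p v" "p w"] vw by simp
    moreover have "(\<Prod>i<n. M i (q i)) = M v (q v) * (M w (q w) * (\<Prod>i\<in>{..<n} - {v, w}. M i (q i)))" for q
      using vw by (simp add: prod.remove[of "{..<n}" v] prod.remove[of "{..<n} - {v}" w]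
          Diff_insert2[symmetric])
    moreover have "t p v = p w" "t p w = p v"
      by (simp_all add: t_def v_def w_def)
    moreover have "(\<Prod>i\<in>{..<n} - {v, w}. M i (t p i)) = (\<Prod>i\<in>{..<n} - {v, w}. M i (p i))"
      by (intro prod.cong) (auto simp: t_def v_def w_def Transposition.transpose_def)
    ultimately show "(\<Prod>i<n. M i (t p i)) = (\<Prod>i<n. M i (p i))"
      by (metis mult.assoc)
  qed
qed

text \<open>All permutations together contribute 1 and those with a clash contribute 0, so some
  clash-free permutation has a nonzero product.\<close>

lemma ex_clash_free:
  "\<exists>p. p permutes {..<n} \<and> (\<forall>i<n. M i (p i) = 1) \<and> (\<nexists>e. clash p e)"
proof -
  let ?f = "\<lambda>p. \<Prod>i<n. M i (p i)"
  have fin: "finite {p. p permutes {..<n}}" by (rule finite_permutations) simp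
  have "(\<Sum>p | p permutes {..<n}. ?f p) =
    (\<Sum>p | p permutes {..<n} \<and> (\<exists>e. clash p e). ?f p) +
    (\<Sum>p | p permutes {..<n} \<and> (\<nexists>e. clash p e). ?f p)"
    using fin by (subst sum.union_disjoint[symmetric]) (auto intro!: sum.cong)
  then have "(\<Sum>p | p permutes {..<n} \<and> (\<nexists>e. clash p e). ?f p) \<noteq> 0"
    using sum_permutations_eq_1[of n M N] MN clash_cancel by simp
  then obtain p where "p permutes {..<n} \<and> (\<nexists>e. clash p e)" "?f p \<noteq> 0"
    by (metis (mono_tags, lifting) mem_Collect_eq sum.neutral)
  then show ?thesis by fastforce
qed

text \<open>A permutation in the support of \<open>M\<close> dominates degrees termwise. Applied to
  an isomorphism and to its inverse, this forces the two degree sums to agree.\<close>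

lemma sum_deg_le: "(\<Sum>i<n. card (nbE i)) \<le> (\<Sum>i<n. card (nbF i))"
proof -
  obtain p where p: "p permutes {..<n}" "\<And>i. i < n \<Longrightarrow> M i (p i) = 1" "\<nexists>e. clash p e"
    using ex_clash_free by blast
  have "(\<Sum>i<n. card (nbE i)) \<le> (\<Sum>i<n. card (nbF (p i)))"
    using p permutes_in_image[OF p(1)] by (intro sum_mono deg_le) auto
  also have "\<dots> = (\<Sum>i<n. card (nbF i))"
    using sum.permute[OF p(1), of "\<lambda>i. card (nbF i)"] by (simp add: comp_def)
  finally show ?thesis .
qed

lemma graph_iso_if_sum_deg_eq:
  assumes deg: "(\<Sum>i<n. card (nbE i)) = (\<Sum>i<n. card (nbF i))"
  obtains p where "p permutes {..<n}" "\<And>i j. i < n \<Longrightarrow> j < n \<Longrightarrow> E i j \<longleftrightarrow> F (p i) (p j)"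
proof -
  obtain p where p: "p permutes {..<n}" "\<And>i. i < n \<Longrightarrow> M i (p i) = 1" "\<nexists>e. clash p e"
    using ex_clash_free by blast
  have lt: "p i < n" if "i < n" for i using permutes_in_image[OF p(1)] that by auto
  have deg_le': "card (nbE i) \<le> card (nbF (p i))" if "i < n" for i
    using that p lt by (intro deg_le)
  have "(\<Sum>i<n. card (nbE i)) = (\<Sum>i<n. card (nbF (p i)))"
    using sum.permute[OF p(1), of "\<lambda>i. card (nbF i)"] deg by (simp add: comp_def)
  \<comment> \<open>A termwise inequality between equal finite sums is an equality in each
    term.\<close>
  then have deg_eq: "card (nbE i) = card (nbF (p i))" if "i < n" for i
    using sum_mono_inv[of "\<lambda>i. card (nbE i)" "{..<n}" "\<lambda>i. card (nbF (p i))" i] deg_le' that by simp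
  have pres: "F (p v) (p w)" if vw: "v < n" "w < n" "E v w" for v w
  proof (rule ccontr)
    assume nF: "\<not> F (p v) (p w)"
    have ne: "p v \<noteq> p w" using vw irr permutes_inj[OF p(1)] by (metis injD)
    \<comment> \<open>The images are not adjacent, so \<open>commM\<close> equates this product of
      ones with the product of the cross entries, which are therefore 1 as well. The equality case
      of the degree bound then applies to rows \<open>v\<close> and \<open>w\<close> and makes the
      images twins.\<close>
    have "M v (p v) * M w (p w) = M v (p w) * M w (p v)"
      using commM[of v w "p v" "p w"] vw lt ne nF by simp
    then have nz: "M v (p w) = 1" "M w (p v) = 1" using p(2) vw by (auto simp: mult_eq_1_bit)
    have "nbF (p v) \<subseteq> nbF (p w)"
      using vw lt nz p(2) ne nF deg_eq by (intro nbF_subset[of v]) auto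
    moreover have "nbF (p w) \<subseteq> nbF (p v)"
      using vw lt nz p(2) ne nF sym(2) deg_eq by (intro nbF_subset[of w]) auto
    ultimately have "clash p (v, w)" using vw by (auto simp: clash_def)
    then show False using p(3) by blast
  qed
  \<comment> \<open>Preserved edges together with equal degrees make \<open>p\<close> map
    neighbourhoods onto neighbourhoods, so edges are reflected too.\<close>
  have im: "p ` nbE i = nbF (p i)" if "i < n" for i
  proof (rule card_subset_eq)
    show "p ` nbE i \<subseteq> nbF (p i)" using that pres lt by auto
    have "inj_on p (nbE i)" using permutes_inj[OF p(1)] by (rule inj_on_subset) simp
    then show "card (p ` nbE i) = card (nbF (p i))" using deg_eq[OF that] by (simp add: card_image)
  qed simp
  show thesis
  proof (rule that[OF p(1)])
    fix i j assume ij: "i < n" "j < n"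
    show "E i j \<longleftrightarrow> F (p i) (p j)"
    proof
      assume "F (p i) (p j)"
      then have "p j \<in> p ` nbE i" using im[OF ij(1)] lt ij by auto
      then show "E i j" using permutes_inj[OF p(1)] by (auto dest: injD)
    qed (use pres ij in blast)
  qed
qed

end


section \<open>A right-angled Artin group determines its graph\<close>

lemma pair_graph_imp_wf: "pair_graph G \<Longrightarrow> pair_wf_digraph G"
  by (rule pair_digraph.pair_wf_digraph[OF pair_graph.axioms(1)])

text \<open>The triple \<open>(x, y, z)\<close> is the integral upper unitriangular 3 by 3 matrix
  with \<open>x\<close>, \<open>y\<close> above the diagonal and \<open>z\<close> in the
  corner.\<close>

definition heisenberg_group :: "(int \<times> int \<times> int) monoid" where
  "heisenberg_group = \<lparr>carrier = UNIV,
     monoid.mult = (\<lambda>(x, y, z) (x', y', z'). (x + x', y + y', z + z' + x * y')), one = (0, 0, 0)\<rparr>"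

lemma heisenberg_simps [simp]:
  "carrier heisenberg_group = UNIV"
  "(x, y, z) \<otimes>\<^bsub>heisenberg_group\<^esub> (x', y', z') = (x + x', y + y', z + z' + x * y')"
  "\<one>\<^bsub>heisenberg_group\<^esub> = (0, 0, 0)"
  by (simp_all add: heisenberg_group_def)

lemma group_heisenberg: "group heisenberg_group"
proof (rule groupI)
  fix p :: "int \<times> int \<times> int"
  obtain x y z where p: "p = (x, y, z)" by (cases p)
  show "\<exists>q\<in>carrier heisenberg_group. q \<otimes>\<^bsub>heisenberg_group\<^esub> p = \<one>\<^bsub>heisenberg_group\<^esub>"
    by (rule bexI[of _ "(- x, - y, x * y - z)"]) (simp_all add: p)
qed (auto simp: algebra_simps split: prod.splits)

lemma fst_heisenberg_mult: "fst (p \<otimes>\<^bsub>heisenberg_group\<^esub> q) = fst p + fst q"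
  and fst_snd_heisenberg_mult: "fst (snd (p \<otimes>\<^bsub>heisenberg_group\<^esub> q)) = fst (snd p) + fst (snd q)"
  by (cases p; cases q; simp)+

lemma heisenberg_commute:
  assumes "p \<otimes>\<^bsub>heisenberg_group\<^esub> q = q \<otimes>\<^bsub>heisenberg_group\<^esub> p"
  shows "fst p * fst (snd q) = fst (snd p) * fst q"
  using assms by (cases p; cases q) (simp add: mult.commute)

text \<open>A coordinate of the abelianization. On the carrier the choice is unique, because a
  homomorphism is determined by its values on generators.\<close>

definition raag_exponent :: "'a pair_pre_digraph \<Rightarrow> 'a \<Rightarrow> 'a word set \<Rightarrow> int" where
  "raag_exponent G a = (SOME h. h \<in> hom (raag G) integer_group \<and>
     (\<forall>v\<in>pverts G. h (raag_gen G v) = of_bool (v = a)))"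

lemma
  assumes "pair_wf_digraph G"
  shows raag_exponent_hom: "raag_exponent G a \<in> hom (raag G) integer_group"
    and raag_exponent_gen: "v \<in> pverts G \<Longrightarrow> raag_exponent G a (raag_gen G v) = of_bool (v = a)"
proof -
  obtain h where "h \<in> hom (raag G) integer_group" "\<And>v. v \<in> pverts G \<Longrightarrow> h (raag_gen G v) = of_bool (v = a)"
    by (rule raag_lift[OF assms group_integer_group, of "\<lambda>v. of_bool (v = a)"]) auto
  then have "\<exists>h. h \<in> hom (raag G) integer_group \<and> (\<forall>v\<in>pverts G. h (raag_gen G v) = of_bool (v = a))"
    by blast
  from someI_ex[OF this, folded raag_exponent_def]
  show "raag_exponent G a \<in> hom (raag G) integer_group"
    "v \<in> pverts G \<Longrightarrow> raag_exponent G a (raag_gen G v) = of_bool (v = a)" by auto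
qed

text \<open>Both sides are homomorphisms in \<open>x\<close> that agree on generators.\<close>

lemma hom_integer_expansion:
  assumes wf: "pair_wf_digraph G" and "finite (pverts G)"
    and h: "h \<in> hom (raag G) integer_group" and x: "x \<in> carrier (raag G)"
  shows "h x = (\<Sum>v\<in>pverts G. raag_exponent G v x * h (raag_gen G v))"
proof (rule raag_hom_eqI[OF wf group_integer_group h _ _ x])
  have "raag_exponent G v (x \<otimes>\<^bsub>raag G\<^esub> y) = raag_exponent G v x + raag_exponent G v y"
    if "x \<in> carrier (raag G)" "y \<in> carrier (raag G)" for v x y
    using hom_mult[OF raag_exponent_hom[OF wf] that] by simp
  then show "(\<lambda>x. \<Sum>v\<in>pverts G. raag_exponent G v x * h (raag_gen G v)) \<in> hom (raag G) integer_group"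
    by (intro homI) (auto simp: distrib_right sum.distrib)
qed (use assms in \<open>simp add: raag_exponent_gen of_bool_def if_distrib[of "\<lambda>x. x * _"] cong: if_cong\<close>)

lemma raag_exponent_commute:
  assumes "pair_graph G" and ab: "a \<noteq> b" "(a, b) \<notin> parcs G"
    and xy: "x \<in> carrier (raag G)" "y \<in> carrier (raag G)" "x \<otimes>\<^bsub>raag G\<^esub> y = y \<otimes>\<^bsub>raag G\<^esub> x"
  shows "raag_exponent G a x * raag_exponent G b y = raag_exponent G b x * raag_exponent G a y"
proof -
  interpret pair_graph G by fact
  have wf: "pair_wf_digraph G" ..
  have ba: "(b, a) \<notin> parcs G" using ab arcs_symmetric by blast
  \<comment> \<open>Every generator other than \<open>a\<close> and \<open>b\<close> goes to the
    identity, so \<open>a\<close>, \<open>b\<close> is the only pair of generators whose images fail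
    to commute, and it is not an edge.\<close>
  obtain h where h: "h \<in> hom (raag G) heisenberg_group"
    "\<And>v. v \<in> pverts G \<Longrightarrow> h (raag_gen G v) = (of_bool (v = a), of_bool (v = b), 0)"
    by (rule raag_lift[OF wf group_heisenberg, of "\<lambda>v. (of_bool (v = a), of_bool (v = b), 0)"])
      (use ab ba in auto)
  have 1: "(\<lambda>z. fst (h z)) \<in> hom (raag G) integer_group"
    using hom_mult[OF h(1)] by (intro homI) (auto simp: fst_heisenberg_mult)
  have 2: "(\<lambda>z. fst (snd (h z))) \<in> hom (raag G) integer_group"
    using hom_mult[OF h(1)] by (intro homI) (auto simp: fst_snd_heisenberg_mult)
  have "fst (h z) = raag_exponent G a z" "fst (snd (h z)) = raag_exponent G b z"
    if z: "z \<in> carrier (raag G)" for z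
    using raag_hom_eqI[OF wf group_integer_group 1 raag_exponent_hom[OF wf, of a] _ z]
      raag_hom_eqI[OF wf group_integer_group 2 raag_exponent_hom[OF wf, of b] _ z]
    by (simp_all add: h raag_exponent_gen[OF wf])
  moreover have "h x \<otimes>\<^bsub>heisenberg_group\<^esub> h y = h y \<otimes>\<^bsub>heisenberg_group\<^esub> h x"
    using hom_mult[OF h(1)] xy by metis
  ultimately show ?thesis using heisenberg_commute[of "h x" "h y"] xy by simp
qed

text \<open>The map induced on abelianizations, reduced mod 2: row \<open>v\<close> lists the
  exponents of the image of the generator \<open>v\<close>.\<close>

definition abel_matrix ::
  "'a pair_pre_digraph \<Rightarrow> 'b pair_pre_digraph \<Rightarrow> ('a word set \<Rightarrow> 'b word set) \<Rightarrow> 'a \<Rightarrow> 'b \<Rightarrow> bit" where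
  "abel_matrix G H f v b = of_int (raag_exponent H b (f (raag_gen G v)))"

text \<open>Expanding the exponent of \<open>w\<close> in \<open>g (f v)\<close> over the generators
  of \<open>H\<close> is matrix multiplication over the integers; the identity is then reduced mod
  2.\<close>

lemma abel_matrix_inverse:
  assumes G: "pair_graph G" and H: "pair_graph H" and f: "f \<in> hom (raag G) (raag H)" and g: "g \<in> hom (raag H) (raag G)"
    and inv: "\<And>x. x \<in> carrier (raag G) \<Longrightarrow> g (f x) = x" and vw: "v \<in> pverts G" "w \<in> pverts G"
  shows "(\<Sum>b\<in>pverts H. abel_matrix G H f v b * abel_matrix H G g b w) = (if v = w then 1 else 0)"
proof -
  interpret G: pair_graph G by fact
  interpret H: pair_graph H by fact
  note wf = pair_graph_imp_wf[OF G] pair_graph_imp_wf[OF H]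
  have "(\<lambda>x. raag_exponent G w (g x)) \<in> hom (raag H) integer_group"
    using hom_compose[OF g raag_exponent_hom[OF wf(1), of w]] by (simp add: comp_def)
  then have "raag_exponent G w (g (f (raag_gen G v))) =
      (\<Sum>b\<in>pverts H. raag_exponent H b (f (raag_gen G v)) * raag_exponent G w (g (raag_gen H b)))"
    using wf vw by (intro hom_integer_expansion H.pair_finite_verts hom_in_carrier[OF f]) auto
  then have eq: "(of_int (of_bool (v = w)) :: bit) = of_int
      (\<Sum>b\<in>pverts H. raag_exponent H b (f (raag_gen G v)) * raag_exponent G w (g (raag_gen H b)))"
    using vw by (simp add: inv raag_exponent_gen[OF wf(1)])
  show ?thesis
    unfolding abel_matrix_def using eq[symmetric] by (simp add: of_bool_def)
qed

lemma abel_matrix_commute: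
  assumes G: "pair_graph G" and H: "pair_graph H" and f: "f \<in> hom (raag G) (raag H)"
    and vw: "(v, w) \<in> parcs G" and ab: "a \<noteq> b" "(a, b) \<notin> parcs H"
  shows "abel_matrix G H f v a * abel_matrix G H f w b = abel_matrix G H f v b * abel_matrix G H f w a"
proof -
  interpret G: pair_graph G by fact
  have wf: "pair_wf_digraph G" ..
  have V: "raag_gen G v \<in> carrier (raag G)" "raag_gen G w \<in> carrier (raag G)"
    using G.wellformed'[OF vw] by simp_all
  have "f (raag_gen G v) \<otimes>\<^bsub>raag H\<^esub> f (raag_gen G w) = f (raag_gen G w) \<otimes>\<^bsub>raag H\<^esub> f (raag_gen G v)"
    using raag_gen_commute[OF wf vw] hom_mult[OF f V] hom_mult[OF f V(2,1)] by simp
  from raag_exponent_commute[OF H ab hom_in_carrier[OF f V(1)] hom_in_carrier[OF f V(2)] this]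
  show ?thesis unfolding abel_matrix_def of_int_mult[symmetric] by simp
qed

theorem raag_iso_imp_graph_iso:
  assumes G: "pair_graph G" and H: "pair_graph H" and "raag G \<cong> raag H"
  obtains p where "bij_betw p (pverts G) (pverts H)"
    "\<And>u v. u \<in> pverts G \<Longrightarrow> v \<in> pverts G \<Longrightarrow> (u, v) \<in> parcs G \<longleftrightarrow> (p u, p v) \<in> parcs H"
proof -
  interpret G: pair_graph G by fact
  interpret H: pair_graph H by fact
  note wf = pair_graph_imp_wf[OF G] pair_graph_imp_wf[OF H]
  obtain f where f: "f \<in> iso (raag G) (raag H)" using assms(3) by (auto simp: is_iso_def)
  define g where "g = inv_into (carrier (raag G)) f"
  have g: "g \<in> iso (raag H) (raag G)"
    unfolding g_def by (rule group.iso_set_sym[OF group_raag[OF wf(1)] f])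
  have bij: "bij_betw f (carrier (raag G)) (carrier (raag H))" using f by (simp add: iso_def)
  have gf: "g (f x) = x" if "x \<in> carrier (raag G)" for x
    unfolding g_def using bij_betw_inv_into_left[OF bij that] .
  have fg: "f (g x) = x" if "x \<in> carrier (raag H)" for x
    unfolding g_def using bij_betw_inv_into_right[OF bij that] .
  have f_hom: "f \<in> hom (raag G) (raag H)" and g_hom: "g \<in> hom (raag H) (raag G)"
    using f g by (simp_all add: iso_def)
  define M where "M = abel_matrix G H f"
  define N where "N = abel_matrix H G g"
  have MN: "(\<Sum>b\<in>pverts H. M v b * N b w) = (if v = w then 1 else 0)"
    if "v \<in> pverts G" "w \<in> pverts G" for v w
    unfolding M_def N_def by (rule abel_matrix_inverse[OF G H f_hom g_hom gf that])
  have NM: "(\<Sum>b\<in>pverts G. N v b * M b w) = (if v = w then 1 else 0)"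
    if "v \<in> pverts H" "w \<in> pverts H" for v w
    unfolding M_def N_def by (rule abel_matrix_inverse[OF H G g_hom f_hom fg that])
  define n where "n = card (pverts G)"
  \<comment> \<open>The matrices are inverse to each other on both sides, so each vertex count
    bounds the other.\<close>
  have n: "card (pverts H) = n"
    unfolding n_def using MN NM
    by (intro antisym card_le_of_left_inverse[of _ _ N M] card_le_of_left_inverse[of _ _ M N])
      auto
  obtain d where d: "bij_betw d {..<n} (pverts G)"
    using ex_bij_betw_nat_finite[OF G.pair_finite_verts] by (auto simp: n_def lessThan_atLeast0)
  obtain e where e: "bij_betw e {..<n} (pverts H)"
    using ex_bij_betw_nat_finite[OF H.pair_finite_verts] by (auto simp: n lessThan_atLeast0)
  have d_in: "d i \<in> pverts G" and e_in: "e i \<in> pverts H" if "i < n" for i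
    using d e that by (auto simp: bij_betw_def)
  have d_eq: "d i = d j \<longleftrightarrow> i = j" and e_eq: "e i = e j \<longleftrightarrow> i = j" if "i < n" "j < n" for i j
    using d e that by (auto simp: bij_betw_def inj_on_eq_iff)
  define E where "E i j \<longleftrightarrow> (d i, d j) \<in> parcs G" for i j
  define F where "F i j \<longleftrightarrow> (e i, e j) \<in> parcs H" for i j
  have sym: "\<And>i j. E i j \<Longrightarrow> E j i" "\<And>i j. F i j \<Longrightarrow> F j i"
    by (auto simp: E_def F_def G.arcs_symmetric H.arcs_symmetric)
  have irr: "\<And>i. \<not> E i i" "\<And>i. \<not> F i i"
    using G.no_loops' H.no_loops' by (auto simp: E_def F_def)
  have M_inv: "(\<Sum>k<n. M (d i) (e k) * N (e k) (d j)) = (if i = j then 1 else 0)" if "i < n" "j < n" for i j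
    using MN[OF d_in d_in, OF that] d_eq[OF that] sum.reindex_bij_betw[OF e, of "\<lambda>b. M (d i) b * N b (d j)"]
    by simp
  have N_inv: "(\<Sum>k<n. N (e i) (d k) * M (d k) (e j)) = (if i = j then 1 else 0)" if "i < n" "j < n" for i j
    using NM[OF e_in e_in, OF that] e_eq[OF that] sum.reindex_bij_betw[OF d, of "\<lambda>b. N (e i) b * M b (e j)"]
    by simp
  have M_comm: "M (d v) (e a) * M (d w) (e b) = M (d v) (e b) * M (d w) (e a)"
    if "v < n" "w < n" "a < n" "b < n" "E v w" "a \<noteq> b" "\<not> F a b" for v w a b
    unfolding M_def using that e_eq by (intro abel_matrix_commute[OF G H f_hom]) (auto simp: E_def F_def)
  have N_comm: "N (e v) (d a) * N (e w) (d b) = N (e v) (d b) * N (e w) (d a)"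
    if "v < n" "w < n" "a < n" "b < n" "F v w" "a \<noteq> b" "\<not> E a b" for v w a b
    unfolding N_def using that d_eq by (intro abel_matrix_commute[OF H G g_hom]) (auto simp: E_def F_def)
  have "(\<Sum>i<n. card {j. j < n \<and> E i j}) \<le> (\<Sum>i<n. card {j. j < n \<and> F i j})"
    by (rule sum_deg_le[OF sym irr M_inv M_comm])
  \<comment> \<open>The roles of the graphs are exchanged by using the matrix of the inverse
    isomorphism.\<close>
  moreover have "(\<Sum>i<n. card {j. j < n \<and> F i j}) \<le> (\<Sum>i<n. card {j. j < n \<and> E i j})"
    by (rule sum_deg_le[OF sym(2,1) irr(2,1) N_inv N_comm])
  ultimately have deg: "(\<Sum>i<n. card {j. j < n \<and> E i j}) = (\<Sum>i<n. card {j. j < n \<and> F i j})"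
    by (rule antisym)
  obtain p where p: "p permutes {..<n}" "\<And>i j. i < n \<Longrightarrow> j < n \<Longrightarrow> E i j \<longleftrightarrow> F (p i) (p j)"
    using graph_iso_if_sum_deg_eq[OF sym irr M_inv M_comm deg] by blast
  let ?q = "e \<circ> p \<circ> inv_into {..<n} d"
  show thesis
  proof (rule that)
    show "bij_betw ?q (pverts G) (pverts H)"
      using bij_betw_inv_into[OF d] permutes_imp_bij[OF p(1)] e by (metis bij_betw_trans)
    fix u v assume "u \<in> pverts G" "v \<in> pverts G"
    then obtain i j where "i < n" "j < n" "u = d i" "v = d j"
      unfolding bij_betw_imp_surj_on[OF d, symmetric] by auto
    moreover from this have "inv_into {..<n} d u = i" "inv_into {..<n} d v = j"
      using d by (auto simp: bij_betw_def)
    ultimately show "(u, v) \<in> parcs G \<longleftrightarrow> (?q u, ?q v) \<in> parcs H"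
      using p(2)[of i j] by (simp add: E_def F_def)
  qed
qed


section \<open>Trees and tree 2-spanners\<close>

lemma pawalk_verts_snoc: "pcas u p w \<Longrightarrow> pawalk_verts u (p @ [(w, v)]) = pawalk_verts u p @ [v]"
  by (induction p arbitrary: u) auto

lemma awalk_leaves:
  assumes "pcas x p y" "x \<in> U" "y \<notin> U"
  shows "\<exists>(u, v) \<in> set p. u \<in> U \<and> v \<notin> U"
  using assms
proof (induction p arbitrary: x)
  case (Cons e p)
  then show ?case by (cases "snd e \<in> U") (auto split: prod.splits)
qed simp

text \<open>A maximal subtree through the root satisfying \<open>P\<close> is all of
  \<open>T\<close>: otherwise connectedness supplies an arc leaving it, and the absence of cycles
  leaves the new vertex only one neighbour in the subtree.\<close>

lemma graph_tree_induct [consumes 2, case_names root grow]: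
  assumes T: "graph_tree T" and r: "r \<in> pverts T"
    and "P {r}"
    and grow: "\<And>U u v. r \<in> U \<Longrightarrow> U \<subseteq> pverts T \<Longrightarrow> u \<in> U \<Longrightarrow> v \<in> pverts T \<Longrightarrow> v \<notin> U \<Longrightarrow> (u, v) \<in> parcs T \<Longrightarrow>
      (\<And>u'. u' \<in> U \<Longrightarrow> (u', v) \<in> parcs T \<Longrightarrow> u' = u) \<Longrightarrow> P U \<Longrightarrow> P (insert v U)"
  shows "P (pverts T)"
proof -
  interpret pair_graph T using T by (simp add: graph_tree_def)
  \<comment> \<open>Paths must stay inside \<open>U\<close>, so that a path between two neighbours
    of an outside vertex avoids that vertex and closes up to a cycle.\<close>
  define conn where "conn U \<longleftrightarrow> (\<forall>x\<in>U. \<forall>y\<in>U. \<exists>p. apath x p y \<and> set (pawalk_verts x p) \<subseteq> U)" for U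
  define \<U> where "\<U> = {U. r \<in> U \<and> U \<subseteq> pverts T \<and> conn U \<and> P U}"
  have "finite \<U>"
    by (rule finite_subset[of _ "Pow (pverts T)"]) (auto simp: \<U>_def pair_finite_verts)
  moreover have "{r} \<in> \<U>"
    using assms by (auto simp: \<U>_def conn_def apath_Nil_iff intro!: exI[of _ "[]"])
  ultimately obtain U where U: "U \<in> \<U>" and max: "\<And>U'. U' \<in> \<U> \<Longrightarrow> U \<subseteq> U' \<Longrightarrow> U' = U"
    using finite_has_maximal[of \<U>] by blast
  have r_U: "r \<in> U" and U_sub: "U \<subseteq> pverts T" and U_conn: "conn U" and U_P: "P U"
    using U by (auto simp: \<U>_def)
  have "U = pverts T"
  proof (rule ccontr)
    assume "U \<noteq> pverts T"
    then obtain y where y: "y \<in> pverts T" "y \<notin> U" using U_sub by blast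
    have "r \<rightarrow>\<^sup>*\<^bsub>with_proj (mk_symmetric (with_proj T))\<^esub> y"
      using T r y(1) by (simp add: graph_tree_def connected_def strongly_connected_def)
    then have "r \<rightarrow>\<^sup>*\<^bsub>with_proj T\<^esub> y" by (simp only: reachable_mk_symmetric_eq[OF sym_arcs])
    then obtain p where p: "awalk r p y"
      unfolding reachable_awalk by (rule exE)
    obtain u v where uv: "(u, v) \<in> set p" "u \<in> U" "v \<notin> U"
      using awalk_leaves[of r p y U] p r_U y by (auto simp: awalk_def)
    then have uv_arc: "(u, v) \<in> parcs T" using p by (auto simp: awalk_def)
    have v: "v \<in> pverts T" using uv_arc by (rule in_arcsD2)
    have unique: "u' = u" if u': "u' \<in> U" "(u', v) \<in> parcs T" for u'
    proof (rule ccontr)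
      assume ne: "u' \<noteq> u"
      obtain q where q: "apath u q u'" "set (pawalk_verts u q) \<subseteq> U"
        using U_conn uv u' unfolding conn_def by blast
      have q_ne: "q \<noteq> []" using q ne by (auto simp: apath_Nil_iff)
      have cas: "pcas u q u'" using q by (auto simp: apath_def awalk_def)
      \<comment> \<open>Out of \<open>v\<close> to \<open>u\<close>, along \<open>q\<close> to
        \<open>u'\<close> and back to \<open>v\<close>; since \<open>u' \<noteq> u\<close>, the path
        \<open>q\<close> is nonempty and there are at least 3 arcs.\<close>
      let ?c = "(v, u) # q @ [(u', v)]"
      have "awalk v ?c v"
        using q(1) u' v arcs_symmetric[OF uv_arc]
        by (auto simp: apath_def awalk_simps awalk_append_iff intro: in_arcsD1)
      moreover have "distinct (tl (pawalk_verts v ?c))"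
        using q uv pawalk_verts_snoc[OF cas, of v] by (auto simp: apath_def)
      ultimately have "cycle ?c" by (auto simp: cycle_def)
      moreover have "3 \<le> length ?c" using q_ne by (cases q) auto
      ultimately show False using T by (auto simp: graph_tree_def)
    qed
    have "conn (insert v U)"
      unfolding conn_def
    proof (intro ballI)
      fix x y assume xy: "x \<in> insert v U" "y \<in> insert v U"
      consider "x = v" "y = v" | "x = v" "y \<in> U" | "x \<in> U" "y = v" | "x \<in> U" "y \<in> U"
        using xy by blast
      then show "\<exists>p. apath x p y \<and> set (pawalk_verts x p) \<subseteq> insert v U"
      proof cases
        case 1
        then show ?thesis using v by (intro exI[of _ "[]"]) (auto simp: apath_Nil_iff)
      next
        case 2
        then obtain q where q: "apath u q y" "set (pawalk_verts u q) \<subseteq> U"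
          using U_conn uv unfolding conn_def by blast
        then show ?thesis
          using 2 uv v arcs_symmetric[OF uv_arc]
          by (intro exI[of _ "(v, u) # q"]) (auto simp: apath_def awalk_Cons_iff)
      next
        case 3
        then obtain q where q: "apath x q u" "set (pawalk_verts x q) \<subseteq> U"
          using U_conn uv unfolding conn_def by blast
        then have "pcas x q u" by (auto simp: apath_def awalk_def)
        from pawalk_verts_snoc[OF this, of v] show ?thesis
          using q 3 uv uv_arc v
          by (intro exI[of _ "q @ [(u, v)]"])
            (auto simp: apath_def awalk_append_iff awalk_simps)
      next
        case 4
        then show ?thesis using U_conn by (fastforce simp: conn_def)
      qed
    qed
    moreover have "P (insert v U)"
      using grow[OF r_U U_sub uv(2) v uv(3) uv_arc unique U_P] .
    ultimately have "insert v U \<in> \<U>" using r_U U_sub v by (simp add: \<U>_def)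
    then show False using max uv by blast
  qed
  then show ?thesis using U_P by simp
qed

lemma graph_tree_vertex_induct [consumes 3, case_names root step]:
  assumes "graph_tree T" "r \<in> pverts T" "v \<in> pverts T"
    and "P r" and "\<And>u v. (u, v) \<in> parcs T \<Longrightarrow> P u \<Longrightarrow> P v"
  shows "P v"
proof -
  have "\<forall>w\<in>pverts T. P w"
    using assms(1,2)
  proof (induction rule: graph_tree_induct)
    case (grow U u w)
    have "P w" by (rule assms(5)[OF grow(6)]) (use grow in blast)
    then show ?case using grow(8) by simp
  qed (simp add: assms(4))
  then show ?thesis using assms(3) by blast
qed

text \<open>\<open>p v\<close> is the product of the labels along the path from \<open>r\<close> to
  \<open>v\<close>. A newly attached vertex has one neighbour in the old part, so its value meets no
  second condition.\<close>

lemma (in group) graph_tree_potential: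
  assumes T: "graph_tree T" and r: "r \<in> pverts T"
    and c: "\<And>u v. (u, v) \<in> parcs T \<Longrightarrow> c u v \<in> carrier G"
      "\<And>u v. (u, v) \<in> parcs T \<Longrightarrow> c v u = inv (c u v)"
  shows "\<exists>p. p r = \<one> \<and> (\<forall>v\<in>pverts T. p v \<in> carrier G) \<and>
    (\<forall>u v. (u, v) \<in> parcs T \<longrightarrow> p v = p u \<otimes> c u v)"
proof -
  interpret T: pair_graph T using T by (simp add: graph_tree_def)
  have "\<exists>p. p r = \<one> \<and> (\<forall>v\<in>pverts T. p v \<in> carrier G) \<and>
    (\<forall>u\<in>pverts T. \<forall>v\<in>pverts T. (u, v) \<in> parcs T \<longrightarrow> p v = p u \<otimes> c u v)"
    using T r
  proof (induction rule: graph_tree_induct)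
    case root
    show ?case using T.no_loops' by (intro exI[of _ "\<lambda>_. \<one>"]) auto
  next
    case (grow U u v)
    then obtain p where p: "p r = \<one>" "\<And>v. v \<in> U \<Longrightarrow> p v \<in> carrier G"
      "\<And>u v. u \<in> U \<Longrightarrow> v \<in> U \<Longrightarrow> (u, v) \<in> parcs T \<Longrightarrow> p v = p u \<otimes> c u v" by blast
    have "p u \<otimes> c u v \<otimes> c v u = p u"
      using p(2)[OF grow(3)] c[OF grow(6)] by (simp add: m_assoc)
    then have bwd: "p y = p u \<otimes> c u v \<otimes> c v y" if "(v, y) \<in> parcs T" "y \<in> U" for y
      using grow(7)[OF that(2) T.arcs_symmetric[OF that(1)]] by simp
    have fwd: "p u \<otimes> c u v = p y \<otimes> c y v" if "(y, v) \<in> parcs T" "y \<in> U" for y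
      using grow(7)[OF that(2,1)] by simp
    let ?p = "p(v := p u \<otimes> c u v)"
    have "?p r = \<one>" using p(1) grow(1,5) by auto
    moreover have "?p y \<in> carrier G" if "y \<in> insert v U" for y
      using that p(2) grow(3) c(1)[OF grow(6)] by auto
    moreover have "?p y = ?p x \<otimes> c x y"
      if xy: "x \<in> insert v U" "y \<in> insert v U" "(x, y) \<in> parcs T" for x y
    proof -
      have "x \<noteq> y" using T.no_loops'[OF xy(3)] .
      then consider "x = v" "y \<in> U" "y \<noteq> v" | "y = v" "x \<in> U" "x \<noteq> v" | "x \<in> U" "y \<in> U" "x \<noteq> v" "y \<noteq> v"
        using xy(1,2) by blast
      then show ?thesis
        using xy(3) bwd fwd p(3) by cases simp_all
    qed
    ultimately show ?case by blast
  qed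
  then show ?thesis using T.wellformed' by blast
qed

section \<open>Consequences of the 2-spanner condition\<close>

lemma
  assumes "tree_2_spanner T G"
  shows tree_2_spanner_verts: "pverts T = pverts G"
    and tree_2_spanner_arcs: "parcs T \<subseteq> parcs G"
    and tree_2_spanner_tree: "graph_tree T"
  using assms by (auto simp: tree_2_spanner_def spanning_def subgraph_def)

lemma tree_2_spanner_arc_cases:
  assumes T: "tree_2_spanner T G" and G: "pair_graph G" and xy: "(x, y) \<in> parcs G"
  obtains "(x, y) \<in> parcs T" | z where "(x, z) \<in> parcs T" "(z, y) \<in> parcs T"
proof -
  interpret G: pair_graph G by fact
  interpret T: pair_graph T using T by (simp add: tree_2_spanner_def graph_tree_def)
  have xy_V: "x \<in> pverts G" "y \<in> pverts G" "x \<noteq> y"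
    using G.wellformed'[OF xy] G.no_loops'[OF xy] by auto
  have "G.awalk x [(x, y)] y" using xy xy_V by (simp add: G.awalk_def)
  then have "graph_dist G x y \<le> 1"
    using G.min_cost_le_walk_cost[of x "[(x, y)]" y "\<lambda>_. 1"] by (simp add: graph_dist_def one_ereal_def)
  then have "2 * graph_dist G x y \<le> 2 * 1" by (intro ereal_mult_left_mono) auto
  moreover have "graph_dist T x y \<le> 2 * graph_dist G x y"
    using T xy_V by (auto simp: tree_2_spanner_def)
  ultimately have "graph_dist T x y \<le> 2" by simp
  also have "(2 :: ereal) < 3"
    using less_ereal.simps(1)[of 2 3] by simp
  finally have "graph_dist T x y < 3" .
  \<comment> \<open>The distance is an infimum of walk costs; the strict bound 3 yields an actual
    walk, of length at most 2.\<close>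
  then obtain p where p: "T.awalk x p y" "ereal (T.awalk_cost (\<lambda>_. 1) p) < 3"
    by (auto simp: graph_dist_def T.\<mu>_def INF_less_iff)
  have "T.awalk_cost (\<lambda>_. 1) p = length p" by (induction p) auto
  then have "length p < 3" using p(2) using less_ereal.simps(1)[of "real (length p)" 3] by simp
  then consider "p = []" | e where "p = [e]" | e f where "p = [e, f]"
    by (cases p; cases "tl p"; cases "tl (tl p)") auto
  then show thesis
    using p(1) xy_V that by cases (auto simp: T.awalk_def)
qed


section \<open>The dual right-angled Artin group of a tree 2-spanner\<close>

lemma (in group) inv_cancel_left:
  assumes "x \<in> carrier G" "y \<in> carrier G"
  shows "inv x \<otimes> (x \<otimes> y) = y" "x \<otimes> (inv x \<otimes> y) = y"
  using assms by (simp_all add: m_assoc[symmetric])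

lemma (in group) commute_inv:
  assumes "x \<in> carrier G" "y \<in> carrier G" "x \<otimes> y = y \<otimes> x"
  shows "x \<otimes> inv y = inv y \<otimes> x"
proof -
  have "inv y \<otimes> (x \<otimes> y) \<otimes> inv y = inv y \<otimes> (y \<otimes> x) \<otimes> inv y" using assms(3) by simp
  then show ?thesis using assms(1,2) by (simp add: m_assoc inv_cancel_left)
qed

text \<open>
  Identifying the dual RAAG \<open>K\<close> with a subgroup of \<open>A\<close>, the element \<open>c u v\<close> below
  stands for \<open>u v\<inverse>\<close>.
\<close>

locale spanned_graph =
  fixes G T :: "'a pair_pre_digraph" and r :: 'a
  assumes G: "pair_graph G" and T: "tree_2_spanner T G" and r: "r \<in> pverts T"
begin

sublocale G: pair_graph G by (rule G)
sublocale T: pair_graph T using tree_2_spanner_tree[OF T] by (simp add: graph_tree_def)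

abbreviation D :: "'a set pair_pre_digraph" where "D \<equiv> dual_graph G T"
abbreviation A :: "'a word set monoid" where "A \<equiv> raag G"
abbreviation K :: "'a set word set monoid" where "K \<equiv> raag D"
abbreviation g :: "'a \<Rightarrow> 'a word set" where "g \<equiv> raag_gen G"

lemma wf_G: "pair_wf_digraph G" by (rule pair_graph_imp_wf[OF G])

lemma wf_D: "pair_wf_digraph D"
  by (rule pair_graph_imp_wf[OF pair_graph_dual_graph[OF T.pair_graph]])

sublocale A: group A by (rule group_raag[OF wf_G])
sublocale K: group K by (rule group_raag[OF wf_D])

lemma arcs_sub: "(u, v) \<in> parcs T \<Longrightarrow> (u, v) \<in> parcs G"
  using tree_2_spanner_arcs[OF T] by blast

lemma verts_eq: "pverts T = pverts G"
  by (rule tree_2_spanner_verts[OF T])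

lemma g_closed [simp]: "v \<in> pverts T \<Longrightarrow> g v \<in> carrier A"
  by (simp add: verts_eq)

text \<open>Generators of \<open>K\<close> are unoriented edges, whereas
  \<open>u v\<inverse>\<close> depends on a direction. One direction per edge is fixed arbitrarily,
  and \<open>c\<close> inverts the generator for the opposite one.\<close>

definition orient :: "'a set \<Rightarrow> 'a \<times> 'a" where
  "orient e = (SOME a. a \<in> parcs T \<and> e = {fst a, snd a})"

definition c :: "'a \<Rightarrow> 'a \<Rightarrow> 'a set word set" where
  "c u v = (if orient {u, v} = (u, v) then raag_gen D {u, v} else inv\<^bsub>K\<^esub> raag_gen D {u, v})"

lemma orient:
  assumes "e \<in> pverts D"
  shows "orient e \<in> parcs T" "e = {fst (orient e), snd (orient e)}"
proof -
  have "\<exists>a. a \<in> parcs T \<and> e = {fst a, snd a}"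
    using assms by (auto simp: dual_graph_def undirected_edges_def)
  from someI_ex[OF this, folded orient_def]
  show "orient e \<in> parcs T" "e = {fst (orient e), snd (orient e)}" by auto
qed

lemma edge_in_D: "(u, v) \<in> parcs T \<Longrightarrow> {u, v} \<in> pverts D"
  by (auto simp: dual_graph_def undirected_edges_def)

lemma orient_arc:
  assumes "(u, v) \<in> parcs T"
  shows "orient {u, v} = (u, v) \<or> orient {u, v} = (v, u)"
  using orient(2)[OF edge_in_D[OF assms]] by (cases "orient {u, v}") (auto simp: doubleton_eq_iff)

lemma c_closed: "(u, v) \<in> parcs T \<Longrightarrow> c u v \<in> carrier K"
  using edge_in_D by (simp add: c_def)

lemma c_swap:
  assumes "(u, v) \<in> parcs T"
  shows "c v u = inv\<^bsub>K\<^esub> c u v"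
  using orient_arc[OF assms] T.no_loops'[OF assms] edge_in_D[OF assms]
  by (auto simp: c_def insert_commute)

lemma gen_D_eq_c:
  assumes "e \<in> pverts D"
  shows "raag_gen D e = c (fst (orient e)) (snd (orient e))"
  using orient[OF assms] by (simp add: c_def)

text \<open>Two distinct edges within a triangle share exactly one vertex; calling it
  \<open>y\<close>, with the arcs directed accordingly, makes them a path of length 2.\<close>

lemma dual_arc_cases:
  assumes "(e, f) \<in> parcs D"
  obtains x y z where "(x, y) \<in> parcs T" "(y, z) \<in> parcs T" "(x, z) \<in> parcs G" "e = {x, y}" "f = {y, z}"
proof -
  obtain x y z where ef: "e \<in> undirected_edges T" "f \<in> undirected_edges T" "e \<noteq> f"
    and tri: "(x, y) \<in> parcs G" "(y, z) \<in> parcs G" "(x, z) \<in> parcs G"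
      "e \<subseteq> {x, y, z}" "f \<subseteq> {x, y, z}"
    using assms by (auto simp: dual_graph_def triangle_def)
  obtain p q p' q' where e: "e = {p, q}" "(p, q) \<in> parcs T" and f: "f = {p', q'}" "(p', q') \<in> parcs T"
    using ef by (auto simp: undirected_edges_def)
  have ne: "p \<noteq> q" "p' \<noteq> q'" using e f T.no_loops' by auto
  have all: "(a, b) \<in> parcs G" if "a \<in> {x, y, z}" "b \<in> {x, y, z}" "a \<noteq> b" for a b
    using that tri G.arcs_symmetric by auto
  have sub: "p \<in> {x, y, z}" "q \<in> {x, y, z}" "p' \<in> {x, y, z}" "q' \<in> {x, y, z}"
    using tri e f by auto
  note sy = T.arcs_symmetric[OF e(2)] T.arcs_symmetric[OF f(2)]
  consider "q = p'" "p \<noteq> q'" | "q = q'" "p \<noteq> p'" | "p = p'" "q \<noteq> q'" | "p = q'" "q \<noteq> p'"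
    using sub ne ef(3) e(1) f(1) by (auto simp: doubleton_eq_iff)
  then show thesis
  proof cases
    case 1
    then show ?thesis using that[of p q q'] e f all sub by auto
  next
    case 2
    then show ?thesis using that[of p q p'] e f all sub sy by (auto simp: insert_commute)
  next
    case 3
    then show ?thesis using that[of q p q'] e f all sub sy by (auto simp: insert_commute)
  next
    case 4
    then show ?thesis using that[of q p p'] e f all sub sy by (auto simp: insert_commute)
  qed
qed

lemma c_commute:
  assumes "(x, y) \<in> parcs T" "(y, z) \<in> parcs T" "(x, z) \<in> parcs G"
  shows "c x y \<otimes>\<^bsub>K\<^esub> c y z = c y z \<otimes>\<^bsub>K\<^esub> c x y"
proof -
  have "x \<noteq> z" "x \<noteq> y" "y \<noteq> z" using assms G.no_loops' arcs_sub by blast+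
  then have ne: "{x, y} \<noteq> {y, z}" by (auto simp: doubleton_eq_iff)
  have "triangle G x y z" using assms arcs_sub by (simp add: triangle_def)
  then have "\<exists>x' y' z'. triangle G x' y' z' \<and> {x, y} \<subseteq> {x', y', z'} \<and> {y, z} \<subseteq> {x', y', z'}"
    by blast
  then have "({x, y}, {y, z}) \<in> parcs D"
    using edge_in_D[OF assms(1)] edge_in_D[OF assms(2)] ne by (simp add: dual_graph_def)
  note comm = raag_gen_commute[OF wf_D this]
  have closed: "raag_gen D {x, y} \<in> carrier K" "raag_gen D {y, z} \<in> carrier K"
    using assms edge_in_D by auto
  \<comment> \<open>Each of the two factors is a generator or its inverse, so all four sign patterns
    are needed.\<close>
  note comm1 = K.commute_inv[OF closed comm] K.commute_inv[OF closed(2,1) comm[symmetric]]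
  show ?thesis
    using comm comm1 K.commute_inv[OF _ _ comm1(1)[symmetric]] closed
    by (simp add: c_def)
qed

text \<open>The universal property of \<open>K\<close> in terms of directed arcs, so that later
  arguments need not refer to \<open>orient\<close>.\<close>

lemma dual_lift:
  fixes H :: "('h, 'i) monoid_scheme"
  assumes H: "group H" and d: "\<And>u v. (u, v) \<in> parcs T \<Longrightarrow> d u v \<in> carrier H"
    "\<And>u v. (u, v) \<in> parcs T \<Longrightarrow> d v u = inv\<^bsub>H\<^esub> d u v"
    "\<And>x y z. (x, y) \<in> parcs T \<Longrightarrow> (y, z) \<in> parcs T \<Longrightarrow> (x, z) \<in> parcs G \<Longrightarrow>
      d x y \<otimes>\<^bsub>H\<^esub> d y z = d y z \<otimes>\<^bsub>H\<^esub> d x y"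
  obtains h where "h \<in> hom K H" "\<And>u v. (u, v) \<in> parcs T \<Longrightarrow> h (c u v) = d u v"
proof -
  interpret H: group H by fact
  define f where "f e = d (fst (orient e)) (snd (orient e))" for e
  have f_closed: "f \<in> pverts D \<rightarrow> carrier H"
    using orient d by (auto simp: f_def)
  have f_eq: "f {u, v} = d u v \<or> f {u, v} = inv\<^bsub>H\<^esub> d u v" if "(u, v) \<in> parcs T" for u v
    using orient_arc[OF that] d(2)[OF that] by (auto simp: f_def)
  have "f e1 \<otimes>\<^bsub>H\<^esub> f e2 = f e2 \<otimes>\<^bsub>H\<^esub> f e1" if e12: "(e1, e2) \<in> parcs D" for e1 e2
  proof -
    obtain x y z where xyz: "(x, y) \<in> parcs T" "(y, z) \<in> parcs T" "(x, z) \<in> parcs G"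
      "e1 = {x, y}" "e2 = {y, z}"
      using e12 by (rule dual_arc_cases)
    note comm = d(3)[OF xyz(1-3)]
    note closed = d(1)[OF xyz(1)] d(1)[OF xyz(2)]
    note comm1 = H.commute_inv[OF closed comm] H.commute_inv[OF closed(2,1) comm[symmetric]]
    show ?thesis
      using comm comm1 H.commute_inv[OF _ _ comm1(1)[symmetric]] closed f_eq[OF xyz(1)] f_eq[OF xyz(2)]
      by (auto simp: xyz)
  qed
  from raag_lift[OF wf_D H f_closed this]
  obtain h where h: "h \<in> hom K H" "\<And>e. e \<in> pverts D \<Longrightarrow> h (raag_gen D e) = f e" by blast
  interpret h: group_hom K H h
    using h(1) by unfold_locales
  have "h (c u v) = d u v" if "(u, v) \<in> parcs T" for u v
    using orient_arc[OF that] h(2)[OF edge_in_D[OF that]] edge_in_D[OF that] d(1,2)[OF that] T.no_loops'[OF that]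
    by (auto simp: c_def f_def)
  with h(1) show thesis by (rule that)
qed

lemma K_hom_eqI:
  assumes "group H" "h \<in> hom K H" "k \<in> hom K H"
    and "\<And>u v. (u, v) \<in> parcs T \<Longrightarrow> h (c u v) = k (c u v)" "x \<in> carrier K"
  shows "h x = k x"
proof (rule raag_hom_eqI[OF wf_D assms(1-3) _ assms(5)])
  fix e assume e: "e \<in> pverts D"
  show "h (raag_gen D e) = k (raag_gen D e)"
    using assms(4) orient(1)[OF e] by (simp add: gen_D_eq_c[OF e])
qed

text \<open>The conjugators at the ends of an arc differ by \<open>c u v\<close> or its inverse, so
  either end may be used. Two arcs meeting at \<open>y\<close> can thus both be conjugated by
  \<open>w y\<close>, which preserves their commutation.\<close>

lemma conj_endo:
  assumes w: "\<And>v. v \<in> pverts T \<Longrightarrow> w v \<in> carrier K"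
    and step: "\<And>u v. (u, v) \<in> parcs T \<Longrightarrow> w v = w u \<otimes>\<^bsub>K\<^esub> c u v \<or> w v = w u \<otimes>\<^bsub>K\<^esub> c v u"
  shows "\<exists>h\<in>hom K K. \<forall>u v. (u, v) \<in> parcs T \<longrightarrow>
    h (c u v) = w v \<otimes>\<^bsub>K\<^esub> c u v \<otimes>\<^bsub>K\<^esub> inv\<^bsub>K\<^esub> w v"
proof -
  have conj_eq: "w v \<otimes>\<^bsub>K\<^esub> c u v \<otimes>\<^bsub>K\<^esub> inv\<^bsub>K\<^esub> w v = w u \<otimes>\<^bsub>K\<^esub> c u v \<otimes>\<^bsub>K\<^esub> inv\<^bsub>K\<^esub> w u"
    if "(u, v) \<in> parcs T" for u v
    using step[OF that] c_swap[OF that] c_closed[OF that] w T.wellformed'[OF that]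
    by (auto simp: K.m_assoc K.inv_mult_group K.inv_cancel_left)
  show ?thesis
  proof (rule dual_lift[OF K.group_axioms, of "\<lambda>u v. w v \<otimes>\<^bsub>K\<^esub> c u v \<otimes>\<^bsub>K\<^esub> inv\<^bsub>K\<^esub> w v"])
    fix u v assume uv: "(u, v) \<in> parcs T"
    show "w v \<otimes>\<^bsub>K\<^esub> c u v \<otimes>\<^bsub>K\<^esub> inv\<^bsub>K\<^esub> w v \<in> carrier K"
      using w c_closed[OF uv] T.wellformed'[OF uv] by simp
    show "w u \<otimes>\<^bsub>K\<^esub> c v u \<otimes>\<^bsub>K\<^esub> inv\<^bsub>K\<^esub> w u = inv\<^bsub>K\<^esub> (w v \<otimes>\<^bsub>K\<^esub> c u v \<otimes>\<^bsub>K\<^esub> inv\<^bsub>K\<^esub> w v)"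
      unfolding conj_eq[OF uv] c_swap[OF uv]
      using w c_closed[OF uv] T.wellformed'[OF uv] by (simp add: K.m_assoc K.inv_mult_group)
  next
    fix x y z assume xyz: "(x, y) \<in> parcs T" "(y, z) \<in> parcs T" "(x, z) \<in> parcs G"
    have "w y \<in> carrier K" using w T.wellformed'[OF xyz(1)] by simp
    moreover from this have "w y \<otimes>\<^bsub>K\<^esub> a \<otimes>\<^bsub>K\<^esub> inv\<^bsub>K\<^esub> w y \<otimes>\<^bsub>K\<^esub> (w y \<otimes>\<^bsub>K\<^esub> b \<otimes>\<^bsub>K\<^esub> inv\<^bsub>K\<^esub> w y) =
        w y \<otimes>\<^bsub>K\<^esub> (a \<otimes>\<^bsub>K\<^esub> b) \<otimes>\<^bsub>K\<^esub> inv\<^bsub>K\<^esub> w y" if "a \<in> carrier K" "b \<in> carrier K" for a b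
      using that by (simp add: K.m_assoc K.inv_cancel_left)
    ultimately show "w y \<otimes>\<^bsub>K\<^esub> c x y \<otimes>\<^bsub>K\<^esub> inv\<^bsub>K\<^esub> w y \<otimes>\<^bsub>K\<^esub> (w z \<otimes>\<^bsub>K\<^esub> c y z \<otimes>\<^bsub>K\<^esub> inv\<^bsub>K\<^esub> w z) =
        w z \<otimes>\<^bsub>K\<^esub> c y z \<otimes>\<^bsub>K\<^esub> inv\<^bsub>K\<^esub> w z \<otimes>\<^bsub>K\<^esub> (w y \<otimes>\<^bsub>K\<^esub> c x y \<otimes>\<^bsub>K\<^esub> inv\<^bsub>K\<^esub> w y)"
      unfolding conj_eq[OF xyz(2)] using c_commute[OF xyz] c_closed xyz by simp
  qed blast
qed

lemma raag_dual_iso: "K \<cong> bestvina_brady G"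
proof -
  note alg = K.m_assoc K.inv_mult_group K.inv_cancel_left
  note algA = A.m_assoc A.inv_mult_group A.inv_cancel_left
  note tree = tree_2_spanner_tree[OF T]
  \<comment> \<open>\<open>p v\<close> stands for \<open>r v\<inverse>\<close> and \<open>q v\<close> for \<open>r\<inverse> v\<close>; \<open>th\<close> and \<open>th'\<close> are
    conjugation by \<open>r\<close> and by its inverse, so \<open>F x\<close> is the action of \<open>x\<close> on \<open>A / \<langle>r\<rangle>\<close>.\<close>
  obtain p where p: "p r = \<one>\<^bsub>K\<^esub>" "\<And>v. v \<in> pverts T \<Longrightarrow> p v \<in> carrier K"
      "\<And>u v. (u, v) \<in> parcs T \<Longrightarrow> p v = p u \<otimes>\<^bsub>K\<^esub> c u v"
    using K.graph_tree_potential[where c = c, OF tree r c_closed c_swap] by auto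
  obtain q where q: "q r = \<one>\<^bsub>K\<^esub>" "\<And>v. v \<in> pverts T \<Longrightarrow> q v \<in> carrier K"
      "\<And>u v. (u, v) \<in> parcs T \<Longrightarrow> q v = q u \<otimes>\<^bsub>K\<^esub> c v u"
    using K.graph_tree_potential[where c = "\<lambda>u v. c v u", OF tree r c_closed[OF T.arcs_symmetric]
        c_swap[OF T.arcs_symmetric]] by auto
  have c_p: "c u v = inv\<^bsub>K\<^esub> p u \<otimes>\<^bsub>K\<^esub> p v" if "(u, v) \<in> parcs T" for u v
    using p(2,3) that T.wellformed'[OF that] c_closed by (simp add: alg)
  have c_q: "c u v = inv\<^bsub>K\<^esub> q v \<otimes>\<^bsub>K\<^esub> q u" if "(u, v) \<in> parcs T" for u v
    using q(2) q(3)[OF T.arcs_symmetric[OF that]] that T.wellformed'[OF that] c_closed by (simp add: alg)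
  obtain th where th: "th \<in> hom K K"
      "\<And>u v. (u, v) \<in> parcs T \<Longrightarrow> th (c u v) = p v \<otimes>\<^bsub>K\<^esub> c u v \<otimes>\<^bsub>K\<^esub> inv\<^bsub>K\<^esub> p v"
    using conj_endo[of p] p by auto
  obtain th' where th': "th' \<in> hom K K"
      "\<And>u v. (u, v) \<in> parcs T \<Longrightarrow> th' (c u v) = q v \<otimes>\<^bsub>K\<^esub> c u v \<otimes>\<^bsub>K\<^esub> inv\<^bsub>K\<^esub> q v"
    using conj_endo[of q] q by auto
  interpret th: group_hom K K th using th(1) by unfold_locales
  interpret th': group_hom K K th' using th'(1) by unfold_locales
  have th_c: "th (c u v) = p v \<otimes>\<^bsub>K\<^esub> inv\<^bsub>K\<^esub> p u" if "(u, v) \<in> parcs T" for u v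
    using th(2)[OF that] c_p[OF that] p(2) T.wellformed'[OF that] by (simp add: alg)
  have th'_c: "th' (c u v) = q u \<otimes>\<^bsub>K\<^esub> inv\<^bsub>K\<^esub> q v" if "(u, v) \<in> parcs T" for u v
    using th'(2)[OF that] c_q[OF that] q(2) T.wellformed'[OF that] by (simp add: alg)
  \<comment> \<open>Conjugating \<open>r\<inverse> v\<close> by \<open>r\<close> gives
    \<open>v r\<inverse>\<close>, the inverse of \<open>r v\<inverse>\<close>.\<close>
  have th_q: "th (q v) = inv\<^bsub>K\<^esub> p v" if "v \<in> pverts T" for v
    using tree r that
  proof (induction rule: graph_tree_vertex_induct)
    case (step u v)
    note V = T.wellformed'[OF step(1)]
    have "th (q v) = th (q u) \<otimes>\<^bsub>K\<^esub> th (c v u)"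
      using q(3)[OF step(1)] q(2) V c_closed[OF T.arcs_symmetric[OF step(1)]] by simp
    then show ?case
      using step(2) th_c[OF T.arcs_symmetric[OF step(1)]] p(2) V by (simp add: alg)
  qed (simp add: p q)
  have th'_p: "th' (p v) = inv\<^bsub>K\<^esub> q v" if "v \<in> pverts T" for v
    using tree r that
  proof (induction rule: graph_tree_vertex_induct)
    case (step u v)
    note V = T.wellformed'[OF step(1)]
    have "th' (p v) = th' (p u) \<otimes>\<^bsub>K\<^esub> th' (c u v)"
      using p(3)[OF step(1)] p(2) V c_closed[OF step(1)] by simp
    then show ?case
      using step(2) th'_c[OF step(1)] q(2) V by (simp add: alg)
  qed (simp add: p q)
  have th_th': "th (th' k) = k" if k: "k \<in> carrier K" for k
  proof (rule K_hom_eqI[OF K.group_axioms _ _ _ k, of "\<lambda>k. th (th' k)" "\<lambda>k. k"])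
    fix u v assume uv: "(u, v) \<in> parcs T"
    note V = T.wellformed'[OF uv]
    show "th (th' (c u v)) = c u v"
      using V th_q p(2) q(2) by (simp add: th'_c[OF uv]) (simp add: c_p[OF uv])
  qed (auto intro!: homI)
  have th'_th: "th' (th k) = k" if k: "k \<in> carrier K" for k
  proof (rule K_hom_eqI[OF K.group_axioms _ _ _ k, of "\<lambda>k. th' (th k)" "\<lambda>k. k"])
    fix u v assume uv: "(u, v) \<in> parcs T"
    note V = T.wellformed'[OF uv]
    show "th' (th (c u v)) = c u v"
      using V th'_p p(2) q(2) by (simp add: th_c[OF uv]) (simp add: c_q[OF uv])
  qed (auto intro!: homI)
  \<comment> \<open>The two sides stand for \<open>r r y\<inverse> x\<inverse>\<close> and
    \<open>r r x\<inverse> y\<inverse>\<close>; their equality is what makes \<open>F x\<close> and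
    \<open>F y\<close> commute.\<close>
  have cocycle_arc: "th (p y) \<otimes>\<^bsub>K\<^esub> p x = th (p x) \<otimes>\<^bsub>K\<^esub> p y" if "(x, y) \<in> parcs T" for x y
  proof -
    note V = T.wellformed'[OF that]
    have "th (p y) = th (p x) \<otimes>\<^bsub>K\<^esub> (p y \<otimes>\<^bsub>K\<^esub> inv\<^bsub>K\<^esub> p x)"
      using p(2) p(3)[OF that] V c_closed[OF that] th_c[OF that] by (metis th.hom_mult)
    then show ?thesis using V p(2) by (simp add: alg)
  qed
  have cocycle: "th (p y) \<otimes>\<^bsub>K\<^esub> p x = th (p x) \<otimes>\<^bsub>K\<^esub> p y" if xy: "(x, y) \<in> parcs G" for x y
    using T G xy
  proof (cases rule: tree_2_spanner_arc_cases)
    case 1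
    then show ?thesis by (rule cocycle_arc)
  next
    \<comment> \<open>The arc \<open>(x, y)\<close> closes a triangle over the tree path through
      \<open>z\<close>, so \<open>c x z\<close> and \<open>c z y\<close> commute and the conjugation
      by \<open>c x z\<close> disappears below.\<close>
    case (2 z)
    note V = T.wellformed'[OF 2(1)] T.wellformed'[OF 2(2)]
    note C = c_closed[OF 2(1)] c_closed[OF 2(2)]
    have "th (p y) = th (p x) \<otimes>\<^bsub>K\<^esub> th (c x z) \<otimes>\<^bsub>K\<^esub> th (c z y)"
      using p(2) V C p(3)[OF 2(1)] p(3)[OF 2(2)] by simp
    also have "\<dots> = th (p x) \<otimes>\<^bsub>K\<^esub> (p z \<otimes>\<^bsub>K\<^esub> inv\<^bsub>K\<^esub> p x \<otimes>\<^bsub>K\<^esub> (p y \<otimes>\<^bsub>K\<^esub> inv\<^bsub>K\<^esub> p z))"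
      using p(2) V by (simp add: alg th_c[OF 2(1)] th_c[OF 2(2)])
    finally have "th (p y) \<otimes>\<^bsub>K\<^esub> p x =
        th (p x) \<otimes>\<^bsub>K\<^esub> (p z \<otimes>\<^bsub>K\<^esub> inv\<^bsub>K\<^esub> p x \<otimes>\<^bsub>K\<^esub> (p y \<otimes>\<^bsub>K\<^esub> inv\<^bsub>K\<^esub> p z) \<otimes>\<^bsub>K\<^esub> p x)"
      using p(2) V by (simp add: alg)
    also have "p z \<otimes>\<^bsub>K\<^esub> inv\<^bsub>K\<^esub> p x \<otimes>\<^bsub>K\<^esub> (p y \<otimes>\<^bsub>K\<^esub> inv\<^bsub>K\<^esub> p z) \<otimes>\<^bsub>K\<^esub> p x =
        p x \<otimes>\<^bsub>K\<^esub> (c x z \<otimes>\<^bsub>K\<^esub> (c x z \<otimes>\<^bsub>K\<^esub> c z y) \<otimes>\<^bsub>K\<^esub> inv\<^bsub>K\<^esub> c x z)"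
      using p(2) V C by (simp add: alg p(3)[OF 2(2)] p(3)[OF 2(1)])
    also have "\<dots> = p x \<otimes>\<^bsub>K\<^esub> (c x z \<otimes>\<^bsub>K\<^esub> c z y)"
      by (subst (1) c_commute[OF 2 xy]) (use C p(2) V in \<open>simp add: alg\<close>)
    also have "\<dots> = p y" using p(2) V C by (simp add: alg p(3)[OF 2(2)] p(3)[OF 2(1)])
    finally show ?thesis .
  qed
  obtain ph where ph: "ph \<in> hom K A" "\<And>u v. (u, v) \<in> parcs T \<Longrightarrow> ph (c u v) = g u \<otimes>\<^bsub>A\<^esub> inv\<^bsub>A\<^esub> g v"
  proof (rule dual_lift[OF A.group_axioms, of "\<lambda>u v. g u \<otimes>\<^bsub>A\<^esub> inv\<^bsub>A\<^esub> g v"])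
    fix x y z assume xyz: "(x, y) \<in> parcs T" "(y, z) \<in> parcs T" "(x, z) \<in> parcs G"
    have V: "g x \<in> carrier A" "g y \<in> carrier A" "g z \<in> carrier A"
      using T.wellformed'[OF xyz(1)] T.wellformed'[OF xyz(2)] by simp_all
    have yz: "g y \<otimes>\<^bsub>A\<^esub> inv\<^bsub>A\<^esub> g z = inv\<^bsub>A\<^esub> g z \<otimes>\<^bsub>A\<^esub> g y"
      by (rule A.commute_inv[OF V(2,3) raag_gen_commute[OF wf_G arcs_sub[OF xyz(2)]]])
    have xz: "g x \<otimes>\<^bsub>A\<^esub> inv\<^bsub>A\<^esub> g z = inv\<^bsub>A\<^esub> g z \<otimes>\<^bsub>A\<^esub> g x"
      by (rule A.commute_inv[OF V(1,3) raag_gen_commute[OF wf_G xyz(3)]])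
    have xy: "g x \<otimes>\<^bsub>A\<^esub> inv\<^bsub>A\<^esub> g y = inv\<^bsub>A\<^esub> g y \<otimes>\<^bsub>A\<^esub> g x"
      by (rule A.commute_inv[OF V(1,2) raag_gen_commute[OF wf_G arcs_sub[OF xyz(1)]]])
    have "g x \<otimes>\<^bsub>A\<^esub> inv\<^bsub>A\<^esub> g y \<otimes>\<^bsub>A\<^esub> (g y \<otimes>\<^bsub>A\<^esub> inv\<^bsub>A\<^esub> g z) = g x \<otimes>\<^bsub>A\<^esub> inv\<^bsub>A\<^esub> g z"
      using V by (simp add: algA)
    also have "\<dots> = g y \<otimes>\<^bsub>A\<^esub> inv\<^bsub>A\<^esub> g z \<otimes>\<^bsub>A\<^esub> (g x \<otimes>\<^bsub>A\<^esub> inv\<^bsub>A\<^esub> g y)"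
      unfolding xz yz xy using V by (simp add: algA)
    finally show "g x \<otimes>\<^bsub>A\<^esub> inv\<^bsub>A\<^esub> g y \<otimes>\<^bsub>A\<^esub> (g y \<otimes>\<^bsub>A\<^esub> inv\<^bsub>A\<^esub> g z) =
        g y \<otimes>\<^bsub>A\<^esub> inv\<^bsub>A\<^esub> g z \<otimes>\<^bsub>A\<^esub> (g x \<otimes>\<^bsub>A\<^esub> inv\<^bsub>A\<^esub> g y)" .
  qed (use T.wellformed' in \<open>auto simp: A.inv_mult_group\<close>)
  interpret ph: group_hom K A ph using ph(1) by unfold_locales
  have ph_p: "ph (p v) = g r \<otimes>\<^bsub>A\<^esub> inv\<^bsub>A\<^esub> g v" if "v \<in> pverts T" for v
    using tree r that
  proof (induction rule: graph_tree_vertex_induct)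
    case (step u v)
    note V = T.wellformed'[OF step(1)]
    show ?case
      using step(2) V p(2) c_closed[OF step(1)] r by (simp add: p(3)[OF step(1)] ph(2)[OF step(1)] algA)
  qed (simp add: p r)
  \<comment> \<open>Both sides are homomorphisms agreeing on the \<open>c u v\<close>, so
    \<open>th\<close> becomes genuine conjugation by \<open>r\<close> in \<open>A\<close>.\<close>
  have ph_th: "ph (th k) = g r \<otimes>\<^bsub>A\<^esub> ph k \<otimes>\<^bsub>A\<^esub> inv\<^bsub>A\<^esub> g r" if k: "k \<in> carrier K" for k
  proof (rule K_hom_eqI[OF A.group_axioms _ _ _ k])
    show "(\<lambda>k. g r \<otimes>\<^bsub>A\<^esub> ph k \<otimes>\<^bsub>A\<^esub> inv\<^bsub>A\<^esub> g r) \<in> hom K A"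
      using r by (auto intro!: homI simp: algA)
    fix u v assume uv: "(u, v) \<in> parcs T"
    note V = T.wellformed'[OF uv]
    have "g u \<otimes>\<^bsub>A\<^esub> inv\<^bsub>A\<^esub> g v = inv\<^bsub>A\<^esub> g v \<otimes>\<^bsub>A\<^esub> g u"
      using V by (intro A.commute_inv raag_gen_commute[OF wf_G arcs_sub[OF uv]]) simp_all
    then show "ph (th (c u v)) = g r \<otimes>\<^bsub>A\<^esub> ph (c u v) \<otimes>\<^bsub>A\<^esub> inv\<^bsub>A\<^esub> g r"
      using V p(2) r by (simp add: th_c[OF uv] ph_p ph(2)[OF uv] algA)
  qed (auto intro!: homI)
  \<comment> \<open>\<open>F x k\<close> stands for \<open>x k r\<inverse>\<close>, the product of
    \<open>(r x\<inverse>)\<inverse>\<close> and \<open>r k r\<inverse>\<close>; it lies in the same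
    coset of \<open>\<langle>r\<rangle>\<close> as \<open>x k\<close>.\<close>
  define F where "F x k = inv\<^bsub>K\<^esub> p x \<otimes>\<^bsub>K\<^esub> th k" for x k
  define F' where "F' x k = th' (p x \<otimes>\<^bsub>K\<^esub> k)" for x k
  have F_closed: "F v k \<in> carrier K" and F'_closed: "F' v k \<in> carrier K"
    and F'_F: "F' v (F v k) = k" and F_F': "F v (F' v k) = k"
    if "v \<in> pverts G" "k \<in> carrier K" for v k
    using that p(2) by (simp_all add: F_def F'_def verts_eq th'_th th_th' K.inv_cancel_left)
  have F_comm: "F x (F y k) = F y (F x k)" if "(x, y) \<in> parcs G" "k \<in> carrier K" for x y k
  proof -
    have V: "p x \<in> carrier K" "p y \<in> carrier K" using p(2) G.wellformed'[OF that(1)] by (simp_all add: verts_eq)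
    have "F x (F y k) = inv\<^bsub>K\<^esub> (th (p y) \<otimes>\<^bsub>K\<^esub> p x) \<otimes>\<^bsub>K\<^esub> th (th k)"
      using V that(2) by (simp add: F_def alg)
    moreover have "F y (F x k) = inv\<^bsub>K\<^esub> (th (p x) \<otimes>\<^bsub>K\<^esub> p y) \<otimes>\<^bsub>K\<^esub> th (th k)"
      using V that(2) by (simp add: F_def alg)
    ultimately show ?thesis by (simp add: cocycle[OF that(1)])
  qed
  from raag_action[where f = F and g = F' and X = "carrier K", OF wf_G F_closed F'_closed F'_F F_F' F_comm]
  obtain \<rho> where \<rho>_one: "\<And>k. k \<in> carrier K \<Longrightarrow> \<rho> \<one>\<^bsub>A\<^esub> k = k"
    and \<rho>_mult: "\<And>a b k. a \<in> carrier A \<Longrightarrow> b \<in> carrier A \<Longrightarrow> k \<in> carrier K \<Longrightarrow> \<rho> (a \<otimes>\<^bsub>A\<^esub> b) k = \<rho> a (\<rho> b k)"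
    and \<rho>_closed: "\<And>a k. a \<in> carrier A \<Longrightarrow> k \<in> carrier K \<Longrightarrow> \<rho> a k \<in> carrier K"
    and \<rho>_gen: "\<And>v k. v \<in> pverts G \<Longrightarrow> k \<in> carrier K \<Longrightarrow> \<rho> (g v) k = F v k"
    and \<rho>_inv: "\<And>v k. v \<in> pverts G \<Longrightarrow> k \<in> carrier K \<Longrightarrow> \<rho> (inv\<^bsub>A\<^esub> g v) k = F' v k"
    by blast
  have gen_ph: "g v \<otimes>\<^bsub>A\<^esub> ph k = ph (F v k) \<otimes>\<^bsub>A\<^esub> g r" if "v \<in> pverts G" "k \<in> carrier K" for v k
    using that p(2) r by (simp add: F_def ph_p ph_th verts_eq[symmetric] algA)
  have inv_gen_ph: "inv\<^bsub>A\<^esub> g v \<otimes>\<^bsub>A\<^esub> ph k = ph (F' v k) \<otimes>\<^bsub>A\<^esub> inv\<^bsub>A\<^esub> g r"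
    if v: "v \<in> pverts G" and k: "k \<in> carrier K" for v k
  proof -
    have "g v \<otimes>\<^bsub>A\<^esub> ph (F' v k) = ph k \<otimes>\<^bsub>A\<^esub> g r"
      using gen_ph[OF v F'_closed[OF v k]] F_F'[OF v k] by simp
    then have "inv\<^bsub>A\<^esub> g v \<otimes>\<^bsub>A\<^esub> (g v \<otimes>\<^bsub>A\<^esub> ph (F' v k)) \<otimes>\<^bsub>A\<^esub> inv\<^bsub>A\<^esub> g r = inv\<^bsub>A\<^esub> g v \<otimes>\<^bsub>A\<^esub> (ph k \<otimes>\<^bsub>A\<^esub> g r) \<otimes>\<^bsub>A\<^esub> inv\<^bsub>A\<^esub> g r"
      by simp
    then show ?thesis using v k r F'_closed[OF v k] by (simp add: algA)
  qed
  note deg_hom = raag_degree_hom[OF wf_G]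
  interpret deg: group_hom A integer_group raag_degree
    using deg_hom by (simp add: group_hom_def group_hom_axioms_def A.group_axioms group_integer_group)
  have deg_gen: "raag_degree (g v) = 1" if "v \<in> pverts G" for v
    using raag_degree_gen[OF that] .
  \<comment> \<open>Moving a letter past \<open>ph\<close> leaves \<open>r\<close> or its inverse on
    the right, according to the sign of the letter, so the power of \<open>r\<close> that
    accumulates is the degree.\<close>
  have spread: "a \<otimes>\<^bsub>A\<^esub> ph k = ph (\<rho> a k) \<otimes>\<^bsub>A\<^esub> (g r [^]\<^bsub>A\<^esub> raag_degree a)"
    if a: "a \<in> carrier A" and k: "k \<in> carrier K" for a k
    using a
  proof (induction rule: raag_induct[OF wf_G, consumes 1, case_names one gen inv_gen])
    case one
    then show ?case using k \<rho>_one deg.hom_one by simp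
  next
    case (gen v a)
    have deg: "raag_degree (g v \<otimes>\<^bsub>A\<^esub> a) = 1 + raag_degree a"
      using gen deg_gen deg.hom_mult[of "g v" a] by simp
    have "g v \<otimes>\<^bsub>A\<^esub> a \<otimes>\<^bsub>A\<^esub> ph k = g v \<otimes>\<^bsub>A\<^esub> ph (\<rho> a k) \<otimes>\<^bsub>A\<^esub> (g r [^]\<^bsub>A\<^esub> raag_degree a)"
      using gen k \<rho>_closed r by (simp add: A.m_assoc)
    also have "\<dots> = ph (\<rho> (g v \<otimes>\<^bsub>A\<^esub> a) k) \<otimes>\<^bsub>A\<^esub> (g r [^]\<^bsub>A\<^esub> raag_degree (g v \<otimes>\<^bsub>A\<^esub> a))"
      using gen k \<rho>_closed[OF gen(2) k] r F_closed
      by (simp add: gen_ph deg \<rho>_mult \<rho>_gen A.m_assoc A.int_pow_mult A.int_pow_1)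
    finally show ?case .
  next
    case (inv_gen v a)
    have deg: "raag_degree (inv\<^bsub>A\<^esub> g v \<otimes>\<^bsub>A\<^esub> a) = - 1 + raag_degree a"
      using inv_gen deg_gen deg.hom_mult[of "inv\<^bsub>A\<^esub> g v" a] deg.hom_inv[of "g v"] by simp
    have pow: "inv\<^bsub>A\<^esub> g r \<otimes>\<^bsub>A\<^esub> (g r [^]\<^bsub>A\<^esub> n) = g r [^]\<^bsub>A\<^esub> (n - 1)" for n :: int
      using A.int_pow_mult[of "g r" "- 1" n] r by (simp add: A.int_pow_neg A.int_pow_1)
    have "inv\<^bsub>A\<^esub> g v \<otimes>\<^bsub>A\<^esub> a \<otimes>\<^bsub>A\<^esub> ph k = inv\<^bsub>A\<^esub> g v \<otimes>\<^bsub>A\<^esub> ph (\<rho> a k) \<otimes>\<^bsub>A\<^esub> (g r [^]\<^bsub>A\<^esub> raag_degree a)"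
      using inv_gen k \<rho>_closed r by (simp add: A.m_assoc)
    also have "\<dots> = ph (\<rho> (inv\<^bsub>A\<^esub> g v \<otimes>\<^bsub>A\<^esub> a) k) \<otimes>\<^bsub>A\<^esub> (g r [^]\<^bsub>A\<^esub> raag_degree (inv\<^bsub>A\<^esub> g v \<otimes>\<^bsub>A\<^esub> a))"
      using inv_gen k \<rho>_closed[OF inv_gen(2) k] r F'_closed
      by (simp add: inv_gen_ph deg \<rho>_mult \<rho>_inv A.m_assoc pow)
    finally show ?case .
  qed
  have deg_ph: "raag_degree (ph k) = 0" if k: "k \<in> carrier K" for k
  proof (rule K_hom_eqI[OF group_integer_group _ _ _ k, of "\<lambda>k. raag_degree (ph k)" "\<lambda>_. 0"])
    fix u v assume uv: "(u, v) \<in> parcs T"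
    show "raag_degree (ph (c u v)) = 0"
      using T.wellformed'[OF uv] deg_gen deg.hom_mult[of "g u" "inv\<^bsub>A\<^esub> g v"] deg.hom_inv[of "g v"]
      by (simp add: ph(2)[OF uv] verts_eq)
  qed (auto intro!: homI simp: deg.hom_mult)
  \<comment> \<open>In \<open>F u (F' v m)\<close> the maps \<open>th\<close> and \<open>th'\<close>
    cancel, leaving the inverse of \<open>p u\<close> times \<open>p v\<close>, that is
    \<open>c u v\<close>, on the left.\<close>
  have \<rho>_ph_c: "\<rho> (ph (c u v)) m = c u v \<otimes>\<^bsub>K\<^esub> m" if uv: "(u, v) \<in> parcs T" and m: "m \<in> carrier K" for u v m
  proof -
    note V = T.wellformed'[OF uv, unfolded verts_eq]
    have "\<rho> (ph (c u v)) m = F u (F' v m)"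
      using V m F'_closed[OF V(2) m] by (simp add: ph(2)[OF uv] \<rho>_mult \<rho>_gen \<rho>_inv)
    then show ?thesis
      using V p(2) m by (simp add: F_def F'_def th_th' c_p[OF uv] verts_eq K.m_assoc)
  qed
  have \<rho>_ph: "\<rho> (ph k) m = k \<otimes>\<^bsub>K\<^esub> m" if k: "k \<in> carrier K" and m: "m \<in> carrier K" for k m
  proof -
    have arc_step: "\<rho> (ph (c u v \<otimes>\<^bsub>K\<^esub> k)) m = c u v \<otimes>\<^bsub>K\<^esub> k \<otimes>\<^bsub>K\<^esub> m"
      if "(u, v) \<in> parcs T" "k \<in> carrier K" "\<rho> (ph k) m = k \<otimes>\<^bsub>K\<^esub> m" for u v k
      using that m c_closed[OF that(1)] by (simp add: \<rho>_mult \<rho>_ph_c K.m_assoc)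
    show ?thesis
      using k
    proof (induction rule: raag_induct[OF wf_D, consumes 1, case_names one gen inv_gen])
      case one
      then show ?case using m \<rho>_one by simp
    next
      case (gen e k)
      then show ?case using orient(1)[OF gen(1)] by (simp add: gen_D_eq_c arc_step)
    next
      case (inv_gen e k)
      have "inv\<^bsub>K\<^esub> raag_gen D e = c (snd (orient e)) (fst (orient e))"
        using c_swap[of "fst (orient e)" "snd (orient e)"] orient(1)[OF inv_gen(1)]
        by (simp add: gen_D_eq_c[OF inv_gen(1)])
      then show ?case
        using inv_gen T.arcs_symmetric[of "fst (orient e)" "snd (orient e)"] orient(1)[OF inv_gen(1)]
        by (simp add: arc_step)
    qed
  qed
  have "inj_on ph (carrier K)"
  proof (rule inj_onI)
    fix k l assume kl: "k \<in> carrier K" "l \<in> carrier K" "ph k = ph l"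
    \<comment> \<open>The action of \<open>ph k\<close> sends the identity to \<open>k\<close>, so
      \<open>ph k\<close> determines \<open>k\<close>.\<close>
    then have "k \<otimes>\<^bsub>K\<^esub> \<one>\<^bsub>K\<^esub> = l \<otimes>\<^bsub>K\<^esub> \<one>\<^bsub>K\<^esub>" by (metis K.one_closed \<rho>_ph)
    then show "k = l" using kl by simp
  qed
  moreover have "ph ` carrier K = kernel A integer_group raag_degree"
  proof
    show "ph ` carrier K \<subseteq> kernel A integer_group raag_degree"
      using deg_ph by (auto simp: kernel_def)
    show "kernel A integer_group raag_degree \<subseteq> ph ` carrier K"
    proof
      fix a assume "a \<in> kernel A integer_group raag_degree"
      then have a: "a \<in> carrier A" "raag_degree a = 0" by (auto simp: kernel_def)
      \<comment> \<open>In degree 0 the power of \<open>r\<close> in \<open>spread\<close> is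
        trivial.\<close>
      have "a = ph (\<rho> a \<one>\<^bsub>K\<^esub>)" using spread[OF a(1) K.one_closed] a \<rho>_closed r by simp
      then show "a \<in> ph ` carrier K" using \<rho>_closed a by blast
    qed
  qed
  ultimately have "ph \<in> iso K (bestvina_brady G)"
    using ph(1) unfolding iso_def bestvina_brady_def hom_def bij_betw_def by auto
  then show ?thesis by (rule is_isoI)
qed

end


section \<open>Isomorphism of Bestvina--Brady groups\<close>

lemma raag_cong:
  assumes G: "pair_graph G" and H: "pair_graph H" and p: "bij_betw p (pverts G) (pverts H)"
    and arcs: "\<And>u v. u \<in> pverts G \<Longrightarrow> v \<in> pverts G \<Longrightarrow> (u, v) \<in> parcs G \<longleftrightarrow> (p u, p v) \<in> parcs H"
  shows "raag G \<cong> raag H"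
proof -
  note wf = pair_graph_imp_wf[OF G] pair_graph_imp_wf[OF H]
  interpret A: group "raag G" by (rule group_raag[OF wf(1)])
  interpret B: group "raag H" by (rule group_raag[OF wf(2)])
  define q where "q = inv_into (pverts G) p"
  have p_in: "p v \<in> pverts H" and qp: "q (p v) = v" if "v \<in> pverts G" for v
    using that p bij_betw_inv_into_left[OF p that] by (auto simp: q_def bij_betw_def)
  have q_in: "q v \<in> pverts G" and pq: "p (q v) = v" if "v \<in> pverts H" for v
    using that bij_betwE[OF bij_betw_inv_into[OF p]] bij_betw_inv_into_right[OF p that] by (auto simp: q_def)
  have comm: "raag_gen H (p u) \<otimes>\<^bsub>raag H\<^esub> raag_gen H (p v) = raag_gen H (p v) \<otimes>\<^bsub>raag H\<^esub> raag_gen H (p u)"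
    if "(u, v) \<in> parcs G" for u v
    using that arcs pair_wf_digraph.in_arcsD1[OF wf(1) that] pair_wf_digraph.in_arcsD2[OF wf(1) that]
    by (intro raag_gen_commute[OF wf(2)]) simp
  have comm': "raag_gen G (q u) \<otimes>\<^bsub>raag G\<^esub> raag_gen G (q v) = raag_gen G (q v) \<otimes>\<^bsub>raag G\<^esub> raag_gen G (q u)"
    if "(u, v) \<in> parcs H" for u v
    using that arcs[of "q u" "q v"] q_in pq
      pair_wf_digraph.in_arcsD1[OF wf(2) that] pair_wf_digraph.in_arcsD2[OF wf(2) that]
    by (intro raag_gen_commute[OF wf(1)]) simp
  have "(\<lambda>v. raag_gen H (p v)) \<in> pverts G \<rightarrow> carrier (raag H)" using p_in by simp
  from raag_lift[OF wf(1) B.group_axioms this comm]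
  obtain h where h: "h \<in> hom (raag G) (raag H)" "\<And>v. v \<in> pverts G \<Longrightarrow> h (raag_gen G v) = raag_gen H (p v)"
    by auto
  have "(\<lambda>v. raag_gen G (q v)) \<in> pverts H \<rightarrow> carrier (raag G)" using q_in by simp
  from raag_lift[OF wf(2) A.group_axioms this comm']
  obtain k where k: "k \<in> hom (raag H) (raag G)" "\<And>v. v \<in> pverts H \<Longrightarrow> k (raag_gen H v) = raag_gen G (q v)"
    by auto
  have id: "(\<lambda>x. x) \<in> hom M M" for M :: "('m, 'n) monoid_scheme"
    by (auto intro!: homI)
  have kh: "k (h x) = x" if x: "x \<in> carrier (raag G)" for x
    using raag_hom_eqI[OF wf(1) A.group_axioms hom_compose[OF h(1) k(1)] id _ x]
    by (simp add: h(2) k(2) p_in qp)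
  have hk: "h (k x) = x" if x: "x \<in> carrier (raag H)" for x
    using raag_hom_eqI[OF wf(2) B.group_axioms hom_compose[OF k(1) h(1)] id _ x]
    by (simp add: h(2) k(2) q_in pq)
  have "bij_betw h (carrier (raag G)) (carrier (raag H))"
    using kh hk hom_carrier[OF h(1)] hom_carrier[OF k(1)]
    by (intro bij_betw_byWitness[where f' = k]) auto
  then show ?thesis using h(1) by (intro is_isoI[of h]) (simp add: iso_def)
qed

text \<open>Tail and head of a pair graph are the two projections, so the arc map of an isomorphism
  is determined by its vertex map.\<close>

lemma digraph_iso_pair_iff:
  assumes G: "pair_wf_digraph G" and H: "pair_wf_digraph H"
  shows "digraph_iso (with_proj G) (with_proj H) \<longleftrightarrow>
    (\<exists>p. bij_betw p (pverts G) (pverts H) \<and>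
      (\<forall>u\<in>pverts G. \<forall>v\<in>pverts G. (u, v) \<in> parcs G \<longleftrightarrow> (p u, p v) \<in> parcs H))"
    (is "?L \<longleftrightarrow> ?R")
proof
  interpret G: pair_wf_digraph G by (rule G)
  interpret H: pair_wf_digraph H by (rule H)
  {
    assume ?L
    then obtain f where f: "G.digraph_isomorphism f" and app: "with_proj H = app_iso f (with_proj G)"
      by (auto simp: digraph_iso_def)
    have verts: "pverts H = iso_verts f ` pverts G" and arcs: "parcs H = iso_arcs f ` parcs G"
      and ends: "iso_tail f = fst" "iso_head f = snd"
      using arg_cong[OF app, of verts] arg_cong[OF app, of arcs] arg_cong[OF app, of tail]
        arg_cong[OF app, of head] by simp_all
    have inj: "inj_on (iso_verts f) (pverts G)"
      using f by (simp add: G.digraph_isomorphism_def)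
    have iso_arc: "iso_arcs f a = (iso_verts f (fst a), iso_verts f (snd a))" if "a \<in> parcs G" for a
      using f that by (simp add: G.digraph_isomorphism_def ends prod_eq_iff)
    have "(u, v) \<in> parcs G \<longleftrightarrow> (iso_verts f u, iso_verts f v) \<in> parcs H"
      if uv: "u \<in> pverts G" "v \<in> pverts G" for u v
    proof
      assume "(u, v) \<in> parcs G"
      then show "(iso_verts f u, iso_verts f v) \<in> parcs H"
        using iso_arc[of "(u, v)"] unfolding arcs by (metis fst_conv image_eqI snd_conv)
    next
      assume "(iso_verts f u, iso_verts f v) \<in> parcs H"
      then obtain a where a: "a \<in> parcs G" "iso_arcs f a = (iso_verts f u, iso_verts f v)"
        by (auto simp: arcs)
      then have "fst a = u" "snd a = v"
        using iso_arc[OF a(1)] inj uv G.wellformed'[of "fst a" "snd a"] by (auto simp: inj_on_eq_iff)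
      then show "(u, v) \<in> parcs G" using a(1) by (cases a) simp
    qed
    then show ?R using inj verts by (auto simp: bij_betw_def intro!: exI[of _ "iso_verts f"])
  next
    assume ?R
    then obtain p where p: "bij_betw p (pverts G) (pverts H)"
      "\<And>u v. u \<in> pverts G \<Longrightarrow> v \<in> pverts G \<Longrightarrow> (u, v) \<in> parcs G \<longleftrightarrow> (p u, p v) \<in> parcs H" by auto
    have inj: "inj_on p (pverts G)" and im: "p ` pverts G = pverts H"
      using p(1) by (auto simp: bij_betw_def)
    define f where "f = \<lparr>iso_verts = p, iso_arcs = map_prod p p, iso_head = snd, iso_tail = fst\<rparr>"
    have sub: "parcs G \<subseteq> pverts G \<times> pverts G" using G.wellformed' by auto
    have "G.digraph_isomorphism f"
      using inj inj_on_subset[OF map_prod_inj_on[OF inj inj] sub] G.wf_digraph_axioms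
      by (simp add: G.digraph_isomorphism_def f_def)
    moreover have "map_prod p p ` parcs G = parcs H"
    proof
      have "(p u, p v) \<in> parcs H" if "(u, v) \<in> parcs G" for u v
        using p(2)[OF G.wellformed'[OF that]] that by simp
      then show "map_prod p p ` parcs G \<subseteq> parcs H" by auto
      show "parcs H \<subseteq> map_prod p p ` parcs G"
      proof
        fix a assume a: "a \<in> parcs H"
        then have "fst a \<in> p ` pverts G" "snd a \<in> p ` pverts G"
          using H.wellformed'[of "fst a" "snd a"] by (simp_all add: im)
        then obtain u v where uv: "u \<in> pverts G" "v \<in> pverts G" "a = (p u, p v)"
          by (metis imageE prod.collapse)
        then have "(u, v) \<in> parcs G" using a p(2) by simp
        then show "a \<in> map_prod p p ` parcs G" using uv(3) by force
      qed
    qed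
    then have "with_proj H = app_iso f (with_proj G)"
      using im by (simp add: with_proj_def app_iso_def f_def)
    ultimately show ?L unfolding digraph_iso_def by blast
  }
qed

theorem raag_iso_iff:
  assumes G: "pair_graph G" and H: "pair_graph H"
  shows "raag G \<cong> raag H \<longleftrightarrow> digraph_iso (with_proj G) (with_proj H)"
proof
  assume "raag G \<cong> raag H"
  then show "digraph_iso (with_proj G) (with_proj H)"
    unfolding digraph_iso_pair_iff[OF pair_graph_imp_wf[OF G] pair_graph_imp_wf[OF H]]
    using raag_iso_imp_graph_iso[OF G H] by metis
next
  assume "digraph_iso (with_proj G) (with_proj H)"
  then show "raag G \<cong> raag H"
    unfolding digraph_iso_pair_iff[OF pair_graph_imp_wf[OF G] pair_graph_imp_wf[OF H]]
    using raag_cong[OF G H] by blast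
qed

lemma bestvina_brady_iso_raag_dual:
  assumes "pair_graph G" "tree_2_spanner T G"
  shows "raag (dual_graph G T) \<cong> bestvina_brady G"
proof -
  have "graph_tree T" by (rule tree_2_spanner_tree[OF assms(2)])
  then have "pverts T \<noteq> {}"
    by (auto simp: graph_tree_def connected_def strongly_connected_def)
  then obtain r where "r \<in> pverts T" by blast
  then interpret spanned_graph G T r using assms by (intro spanned_graph.intro)
  show ?thesis by (rule raag_dual_iso)
qed

theorem corollary1:
  fixes \<Gamma> T\<^sub>\<Gamma> :: "'a pair_pre_digraph" and \<Lambda> T\<^sub>\<Lambda> :: "'b pair_pre_digraph"
  assumes "pair_graph \<Gamma>" and "Digraph_Component.connected (with_proj \<Gamma>)"
    and "pair_graph \<Lambda>" and "Digraph_Component.connected (with_proj \<Lambda>)"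
    and "tree_2_spanner T\<^sub>\<Gamma> \<Gamma>" and "tree_2_spanner T\<^sub>\<Lambda> \<Lambda>"
  shows "bestvina_brady \<Gamma> \<cong> bestvina_brady \<Lambda> \<longleftrightarrow>
    digraph_iso (with_proj (dual_graph \<Gamma> T\<^sub>\<Gamma>)) (with_proj (dual_graph \<Lambda> T\<^sub>\<Lambda>))"
proof -
  have T: "pair_graph T\<^sub>\<Gamma>" "pair_graph T\<^sub>\<Lambda>"
    using assms(5,6) by (simp_all add: tree_2_spanner_def graph_tree_def)
  note D = pair_graph_dual_graph[OF T(1), of \<Gamma>] pair_graph_dual_graph[OF T(2), of \<Lambda>]
  note grp = group_raag[OF pair_graph_imp_wf[OF D(1)]] group_raag[OF pair_graph_imp_wf[OF D(2)]]
  note iso = bestvina_brady_iso_raag_dual[OF assms(1,5)] bestvina_brady_iso_raag_dual[OF assms(3,6)]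
  \<comment> \<open>Each Bestvina--Brady group is replaced by the RAAG on its dual graph, which in
    turn determines that graph.\<close>
  have "bestvina_brady \<Gamma> \<cong> bestvina_brady \<Lambda> \<longleftrightarrow>
      raag (dual_graph \<Gamma> T\<^sub>\<Gamma>) \<cong> raag (dual_graph \<Lambda> T\<^sub>\<Lambda>)"
  proof
    assume "bestvina_brady \<Gamma> \<cong> bestvina_brady \<Lambda>"
    then have "raag (dual_graph \<Gamma> T\<^sub>\<Gamma>) \<cong> bestvina_brady \<Lambda>" by (rule iso_trans[OF iso(1)])
    then show "raag (dual_graph \<Gamma> T\<^sub>\<Gamma>) \<cong> raag (dual_graph \<Lambda> T\<^sub>\<Lambda>)"
      by (rule iso_trans) (rule group.iso_sym[OF grp(2) iso(2)])
  next
    assume "raag (dual_graph \<Gamma> T\<^sub>\<Gamma>) \<cong> raag (dual_graph \<Lambda> T\<^sub>\<Lambda>)"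
    then have "bestvina_brady \<Gamma> \<cong> raag (dual_graph \<Lambda> T\<^sub>\<Lambda>)"
      by (rule iso_trans[OF group.iso_sym[OF grp(1) iso(1)]])
    then show "bestvina_brady \<Gamma> \<cong> bestvina_brady \<Lambda>" by (rule iso_trans) (rule iso(2))
  qed
  then show ?thesis by (simp add: raag_iso_iff[OF D])
qed

end
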